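(* Let $\kappa_v,\kappa_f,a_v,a_f,\sigma_v,\sigma_f>0$, $\theta_v,\theta_f\ge0$, and let $V_0,r_0^f>0$ be deterministic. Let $V$ be the pathwise unique non-negative strong solution, up to a Markov time $\tau_0^V$, of $$dV(t)=\kappa_v(a_v-V(t-))\,dt+\theta_v\,d\gamma(t)+\sigma_v\sqrt{V(t-)}\,d\Gamma_2(t),\qquad V(0)=V_0.$$ Then there exists a Markov time $\tau_0^f$ such that the equation $$dr^f(t)=\Big(\kappa_f(a_f-r^f(t-))-\sigma_f\rho_{sf}\sqrt{V(t-)\,r^f(t-)}\Big)dt+\theta_f\,d\gamma(t)+\sigma_f\sqrt{r^f(t-)}\,d\Gamma_4(t),\qquad r^f(0)=r_0^f,$$ admits a pathwise unique non-negative strong solution up to $\tau_0^f$.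
   Context: Setting. $(\Omega,\mathcal F,\{\mathcal F_t\}_{t\ge0},\mathbf Q)$ is a complete filtered probability space. $\mathbf W=(W_1,W_2,W_3,W_4)$ is a $4$-dimensional Brownian motion with instantaneous correlation matrix $$\Sigma_{\mathbf W}=\begin{pmatrix}1&\rho_{sv}&\rho_{sd}&\rho_{sf}\\ \rho_{sv}&1&\rho_{vd}&\rho_{vf}\\ \rho_{sd}&\rho_{vd}&1&\rho_{df}\\ \rho_{sf}&\rho_{vf}&\rho_{df}&1\end{pmatrix},$$ assumed positive definite with all off-diagonal entries in $(-1,1)$; $\rho_{sf}$ in the equation is the entry of this matrix. $\gamma$ is a Gamma subordinator independent of $\mathbf W$: a pure-jump increasing Lévy process with $\gamma(0)=0$ and Lévy measure $g_\gamma(s)\,ds=\frac{\alpha}{s}e^{-\beta s}1_{(0,+\infty)}(s)\,ds$, where $\alpha,\beta>0$ are fixed. $\Gamma_j(t)=W_j(\gamma(t))$, $j=1,\dots,4$; the paths of $\Gamma_j$ are a.s. of bounded variation. $f(t-)$ denotes the left limit of $f$ at $t$. A Markov time is a stopping time. A strong solution of an equation up to a Markov time $\tau$ (with $\mathbf Q(\tau>0)=1$) is a càdlàg process defined on $[0,\tau)$, adapted to the usual augmentation of the filtration generated by the driving processes ($(\gamma,\Gamma_2)$ for $V$; $(\gamma,\Gamma_2,\Gamma_4)$ for $r^f$, whose equation involves $V$, so that $\tau\le\tau_0^V$ there), satisfying the integral form of the equation for all $t<\tau$ almost surely. Non-negative means $\ge 0$ on $[0,\tau)$. Pathwise unique means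 that any other strong solution of the same equation (same initial datum, same driving processes) up to a Markov time $\widetilde\tau$ with $\mathbf Q(\widetilde\tau>0)=1$ coincides with it almost surely on $[0,\tau\wedge\widetilde\tau)$. (It is known that the equation for $V$ has a pathwise unique non-negative strong solution up to some Markov time $\tau_0^V$.) *)

theory Defs
  imports "HOL-Probability.Probability"
begin

text \<open>
  Conventions. Processes are functions \<open>X t \<omega>\<close> of a real time \<open>t\<close>; only times \<open>t \<ge> 0\<close> matter.
  Filtrations are indexed by \<^typ>\<open>ennreal\<close>, so that stopping times may take the value
  \<open>\<infinity>\<close> and \<^const>\<open>stopping_time\<close> applies. Path properties hold almost surely.
\<close>

section \<open>Paths\<close>

definition left_lim :: "(real \<Rightarrow> real) \<Rightarrow> real \<Rightarrow> real"
  where "left_lim f t = Lim (at_left t) f"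

definition jump :: "(real \<Rightarrow> real) \<Rightarrow> real \<Rightarrow> real"
  where "jump f t = f t - left_lim f t"

definition cadlag_before :: "ennreal \<Rightarrow> (real \<Rightarrow> real) \<Rightarrow> bool"
  where "cadlag_before T f \<longleftrightarrow>
    (\<forall>t\<ge>0. ennreal t < T \<longrightarrow>
      (f \<longlongrightarrow> f t) (at_right t) \<and> (0 < t \<longrightarrow> (\<exists>l. (f \<longlongrightarrow> l) (at_left t))))"

definition variation_sums :: "(real \<Rightarrow> real) \<Rightarrow> real \<Rightarrow> real \<Rightarrow> real set"
  where "variation_sums f a b = {(\<Sum>K\<in>d. \<bar>f (Sup K) - f (Inf K)\<bar>) | d. d division_of {a..b}}"

definition bounded_variation_on :: "(real \<Rightarrow> real) \<Rightarrow> real \<Rightarrow> real \<Rightarrow> bool"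
  where "bounded_variation_on f a b \<longleftrightarrow> bdd_above (variation_sums f a b)"

definition total_variation :: "(real \<Rightarrow> real) \<Rightarrow> real \<Rightarrow> real \<Rightarrow> real"
  where "total_variation f a b = Sup (variation_sums f a b)"

text \<open>
  The pathwise Lebesgue--Stieltjes integral of \<open>h\<close> over \<open>(0, t]\<close> against an integrator \<open>g\<close> that is
  right-continuous and of bounded variation on every \<open>[0, s]\<close>. By the Jordan decomposition
  \<open>g = g 0 + P - N\<close> on \<open>[0, \<infinity>)\<close> with \<open>P\<close>, \<open>N\<close> the positive and negative variation.
  They are extended to negative times by \<open>0\<close>.
\<close>

definition pos_variation :: "(real \<Rightarrow> real) \<Rightarrow> real \<Rightarrow> real"
  where "pos_variation g s = (total_variation g 0 (max 0 s) + (g (max 0 s) - g 0)) / 2"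

definition neg_variation :: "(real \<Rightarrow> real) \<Rightarrow> real \<Rightarrow> real"
  where "neg_variation g s = (total_variation g 0 (max 0 s) - (g (max 0 s) - g 0)) / 2"

definition stieltjes_integral :: "(real \<Rightarrow> real) \<Rightarrow> (real \<Rightarrow> real) \<Rightarrow> real \<Rightarrow> real"
  where "stieltjes_integral g h t =
    (LINT s:{0<..t}|interval_measure (pos_variation g). h s)
    - (LINT s:{0<..t}|interval_measure (neg_variation g). h s)"

section \<open>Filtrations\<close>

definition complete_filtered_prob_space :: "'a measure \<Rightarrow> (ennreal \<Rightarrow> 'a measure) \<Rightarrow> bool"
  where "complete_filtered_prob_space M F \<longleftrightarrow>
    prob_space M \<and> complete_measure M \<and> filtration (space M) F \<and>
    (\<forall>t. sets (F t) \<subseteq> sets M) \<and> null_sets M \<subseteq> sets (F 0)"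

definition process_sets ::
    "'a measure \<Rightarrow> real set \<Rightarrow> (real \<Rightarrow> 'a \<Rightarrow> 'b::topological_space) \<Rightarrow> 'a set set"
  where "process_sets M I X = {X t -` A \<inter> space M | t A. t \<in> I \<and> A \<in> sets borel}"

text \<open>
  The usual augmentation of the filtration generated by a set \<open>D\<close> of real processes: add all null
  sets of \<open>M\<close>, then make the result right-continuous. At \<open>t = \<infinity>\<close> the formula gives \<^term>\<open>sets M\<close>.
\<close>

definition usual_augmentation ::
    "'a measure \<Rightarrow> (real \<Rightarrow> 'a \<Rightarrow> real) set \<Rightarrow> ennreal \<Rightarrow> 'a measure"
  where "usual_augmentation M D t =
    sigma (space M)
      {A \<in> sets M. \<forall>u. t < ennreal u \<longrightarrow>
         A \<in> sigma_sets (space M) ((\<Union>X\<in>D. process_sets M {0..u} X) \<union> null_sets M)}"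

section \<open>The driving processes\<close>

definition positive_definite :: "real^'n^'n \<Rightarrow> bool"
  where "positive_definite S \<longleftrightarrow> transpose S = S \<and> (\<forall>u. u \<noteq> 0 \<longrightarrow> 0 < u \<bullet> (S *v u))"

definition corr_matrix ::
    "real \<Rightarrow> real \<Rightarrow> real \<Rightarrow> real \<Rightarrow> real \<Rightarrow> real \<Rightarrow> real^4^4"
  where "corr_matrix \<rho>sv \<rho>sd \<rho>sf \<rho>vd \<rho>vf \<rho>df =
    vector [vector [1, \<rho>sv, \<rho>sd, \<rho>sf],
            vector [\<rho>sv, 1, \<rho>vd, \<rho>vf],
            vector [\<rho>sd, \<rho>vd, 1, \<rho>df],
            vector [\<rho>sf, \<rho>vf, \<rho>df, 1]]"

definition adapted_independent_increments ::
    "'a measure \<Rightarrow> (ennreal \<Rightarrow> 'a measure) \<Rightarrow> (real \<Rightarrow> 'a \<Rightarrow> 'b::real_normed_vector) \<Rightarrow> bool"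
  where "adapted_independent_increments M F X \<longleftrightarrow>
    (\<forall>t\<ge>0. X t \<in> borel_measurable (F (ennreal t))) \<and>
    (\<forall>s\<ge>0. \<forall>t\<ge>s. prob_space.indep_set M (sets (F (ennreal s)))
       (sets (vimage_algebra (space M) (\<lambda>\<omega>. X t \<omega> - X s \<omega>) borel)))"

text \<open>
  A Brownian motion with positive definite instantaneous covariance matrix \<open>S\<close>: the increment over
  \<open>[s, t]\<close> is a centred Gaussian vector with covariance \<open>(t - s) S\<close>, i.e. all its (nontrivial) linear
  functionals are normally distributed with the corresponding variance.
\<close>

definition brownian_motion ::
    "'a measure \<Rightarrow> (ennreal \<Rightarrow> 'a measure) \<Rightarrow> real^'n^'n \<Rightarrow> (real \<Rightarrow> 'a \<Rightarrow> real^'n) \<Rightarrow> bool"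
  where "brownian_motion M F S W \<longleftrightarrow>
    adapted_independent_increments M F W \<and>
    (AE \<omega> in M. W 0 \<omega> = 0) \<and>
    (AE \<omega> in M. continuous_on {0..} (\<lambda>t. W t \<omega>)) \<and>
    (\<forall>s\<ge>0. \<forall>t>s. \<forall>u. u \<noteq> 0 \<longrightarrow>
       distributed M lborel (\<lambda>\<omega>. u \<bullet> (W t \<omega> - W s \<omega>))
         (normal_density 0 (sqrt ((t - s) * (u \<bullet> (S *v u))))))"

definition levy_process ::
    "'a measure \<Rightarrow> (ennreal \<Rightarrow> 'a measure) \<Rightarrow> (real \<Rightarrow> 'a \<Rightarrow> real) \<Rightarrow> bool"
  where "levy_process M F X \<longleftrightarrow>
    adapted_independent_increments M F X \<and>
    (AE \<omega> in M. X 0 \<omega> = 0) \<and>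
    (AE \<omega> in M. cadlag_before \<infinity> (\<lambda>t. X t \<omega>)) \<and>
    (\<forall>s\<ge>0. \<forall>t\<ge>s. distr M borel (\<lambda>\<omega>. X t \<omega> - X s \<omega>) = distr M borel (X (t - s)))"

text \<open>
  The Levy measure of \<open>X\<close> gives a Borel set \<open>A\<close> not containing \<open>0\<close> the expected number of jumps of
  \<open>X\<close> in \<open>(0, 1]\<close> whose size lies in \<open>A\<close>.
\<close>

definition has_levy_measure ::
    "'a measure \<Rightarrow> (real \<Rightarrow> 'a \<Rightarrow> real) \<Rightarrow> real measure \<Rightarrow> bool"
  where "has_levy_measure M X \<nu> \<longleftrightarrow>
    (\<forall>A\<in>sets borel. 0 \<notin> A \<longrightarrow>
      (\<integral>\<^sup>+\<omega>. emeasure (count_space UNIV) {s \<in> {0<..1}. jump (\<lambda>t. X t \<omega>) s \<in> A} \<partial>M) = emeasure \<nu> A)"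

definition gamma_subordinator ::
    "'a measure \<Rightarrow> (ennreal \<Rightarrow> 'a measure) \<Rightarrow> real \<Rightarrow> real \<Rightarrow> (real \<Rightarrow> 'a \<Rightarrow> real) \<Rightarrow> bool"
  where "gamma_subordinator M F \<alpha> \<beta> X \<longleftrightarrow>
    levy_process M F X \<and>
    (AE \<omega> in M. mono_on {0..} (\<lambda>t. X t \<omega>)) \<and>
    (AE \<omega> in M. \<forall>t\<ge>0. (jump (\<lambda>t. X t \<omega>) has_sum X t \<omega>) {0<..t}) \<and>
    has_levy_measure M X
      (density lborel (\<lambda>s. ennreal (\<alpha> / s * exp (- \<beta> * s) * indicator {0<..} s)))"

definition independent_processes ::
    "'a measure \<Rightarrow> (real \<Rightarrow> 'a \<Rightarrow> 'b::topological_space) \<Rightarrow> (real \<Rightarrow> 'a \<Rightarrow> 'c::topological_space) \<Rightarrow> bool"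
  where "independent_processes M X Y \<longleftrightarrow>
    prob_space.indep_set M
      (sigma_sets (space M) (process_sets M {0..} X))
      (sigma_sets (space M) (process_sets M {0..} Y))"

definition time_changed :: "(real \<Rightarrow> 'a \<Rightarrow> real^'n) \<Rightarrow> (real \<Rightarrow> 'a \<Rightarrow> real) \<Rightarrow> 'n \<Rightarrow> real \<Rightarrow> 'a \<Rightarrow> real"
  where "time_changed W \<gamma> j t \<omega> = W (\<gamma> t \<omega>) \<omega> $ j"

section \<open>Strong solutions up to a Markov time\<close>

text \<open>
  \<open>D\<close> is the set of driving processes. \<open>E \<omega> x t\<close> says that the path \<open>x\<close> satisfies the integral
  form of the equation at time \<open>t\<close> on the outcome \<open>\<omega>\<close>. The equation makes sense on \<open>[0, H)\<close> only,
  where \<open>H\<close> is a random horizon (\<open>\<infinity>\<close> if there is no restriction). Markov times are stopping times of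
  the usual augmentation of the filtration generated by \<open>D\<close>, so the event \<open>t < \<tau>\<close> belongs to it,
  and a process on \<open>[0, \<tau>)\<close> is adapted if \<open>X t\<close> is measurable on that event.
\<close>

definition strong_solution ::
    "'a measure \<Rightarrow> (real \<Rightarrow> 'a \<Rightarrow> real) set \<Rightarrow> ('a \<Rightarrow> ennreal) \<Rightarrow> ('a \<Rightarrow> (real \<Rightarrow> real) \<Rightarrow> real \<Rightarrow> bool) \<Rightarrow>
     ('a \<Rightarrow> ennreal) \<Rightarrow> (real \<Rightarrow> 'a \<Rightarrow> real) \<Rightarrow> bool"
  where "strong_solution M D H E \<tau> X \<longleftrightarrow>
    stopping_time (usual_augmentation M D) \<tau> \<and>
    (AE \<omega> in M. 0 < \<tau> \<omega>) \<and>
    (AE \<omega> in M. \<tau> \<omega> \<le> H \<omega>) \<and>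
    (\<forall>t\<ge>0. X t \<in> borel_measurable
       (restrict_space (usual_augmentation M D (ennreal t)) {\<omega> \<in> space M. ennreal t < \<tau> \<omega>})) \<and>
    (AE \<omega> in M. cadlag_before (\<tau> \<omega>) (\<lambda>t. X t \<omega>)) \<and>
    (AE \<omega> in M. \<forall>t\<ge>0. ennreal t < \<tau> \<omega> \<longrightarrow> E \<omega> (\<lambda>s. X s \<omega>) t)"

definition pathwise_unique_nonneg_strong_solution ::
    "'a measure \<Rightarrow> (real \<Rightarrow> 'a \<Rightarrow> real) set \<Rightarrow> ('a \<Rightarrow> ennreal) \<Rightarrow> ('a \<Rightarrow> (real \<Rightarrow> real) \<Rightarrow> real \<Rightarrow> bool) \<Rightarrow>
     ('a \<Rightarrow> ennreal) \<Rightarrow> (real \<Rightarrow> 'a \<Rightarrow> real) \<Rightarrow> bool"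
  where "pathwise_unique_nonneg_strong_solution M D H E \<tau> X \<longleftrightarrow>
    strong_solution M D H E \<tau> X \<and>
    (AE \<omega> in M. \<forall>t\<ge>0. ennreal t < \<tau> \<omega> \<longrightarrow> 0 \<le> X t \<omega>) \<and>
    (\<forall>\<tau>' Y. strong_solution M D H E \<tau>' Y \<longrightarrow>
       (AE \<omega> in M. \<forall>t\<ge>0. ennreal t < min (\<tau> \<omega>) (\<tau>' \<omega>) \<longrightarrow> Y t \<omega> = X t \<omega>))"

text \<open>
  The integral forms of the two equations, for the path \<open>x\<close> with initial value \<open>x0\<close>, driven by the
  paths \<open>g\<close> of the subordinator and \<open>G\<close> of the time-changed Brownian motion; at \<open>t = 0\<close> they reduce
  to the initial condition \<open>x 0 = x0\<close>. As \<^const>\<open>sqrt\<close> is total (and odd), nonnegativity of the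
  radicands is required explicitly.
\<close>

definition variance_equation ::
    "real \<Rightarrow> real \<Rightarrow> real \<Rightarrow> real \<Rightarrow> real \<Rightarrow> (real \<Rightarrow> real) \<Rightarrow> (real \<Rightarrow> real) \<Rightarrow>
     (real \<Rightarrow> real) \<Rightarrow> real \<Rightarrow> bool"
  where "variance_equation \<kappa> a \<theta> \<sigma> x0 g G x t \<longleftrightarrow>
    (\<forall>s\<in>{0<..t}. 0 \<le> left_lim x s) \<and>
    x t = x0 + (LINT s:{0..t}|lborel. \<kappa> * (a - left_lim x s))
      + \<theta> * (g t - g 0)
      + \<sigma> * stieltjes_integral G (\<lambda>s. sqrt (left_lim x s)) t"

text \<open>In the foreign rate equation \<open>v\<close> is the variance path.\<close>

definition foreign_rate_equation ::
    "real \<Rightarrow> real \<Rightarrow> real \<Rightarrow> real \<Rightarrow> real \<Rightarrow> real \<Rightarrow> (real \<Rightarrow> real) \<Rightarrow> (real \<Rightarrow> real) \<Rightarrow> (real \<Rightarrow> real) \<Rightarrow>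
     (real \<Rightarrow> real) \<Rightarrow> real \<Rightarrow> bool"
  where "foreign_rate_equation \<kappa> a \<theta> \<sigma> \<rho> x0 v g G x t \<longleftrightarrow>
    (\<forall>s\<in>{0<..t}. 0 \<le> left_lim x s \<and> 0 \<le> left_lim v s * left_lim x s) \<and>
    x t = x0 + (LINT s:{0..t}|lborel.
        \<kappa> * (a - left_lim x s) - \<sigma> * \<rho> * sqrt (left_lim v s * left_lim x s))
      + \<theta> * (g t - g 0)
      + \<sigma> * stieltjes_integral G (\<lambda>s. sqrt (left_lim x s)) t"

end

theory Submission
  imports Defs
begin

text \<open>
  The equation is solved path by path on a random interval \<open>[0, \<tau>)\<close> so short that no stochastic
  calculus is needed. Let \<open>m t\<close> be the sum of \<open>t\<close>, the increment of \<open>\<gamma>\<close> over \<open>[0, t]\<close> and the total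
  variation of \<open>\<Gamma>\<^sub>4\<close> there; it is right-continuous with \<open>m 0 = 0\<close>, so \<open>m\<close> stays below any
  given \<open>\<epsilon> > 0\<close> and \<open>V\<close> below \<open>V0 + 1\<close> for a short positive time. As long as a path has values in
  \<open>[r0/2, 2 r0]\<close> the square roots are Lipschitz, and for small \<open>\<epsilon>\<close> the right-hand side of the equation
  is a contraction of the supremum norm which keeps paths well inside this band. This gives existence
  by Picard iteration and, since no competitor can leave the band first, uniqueness among all solutions.

  Since the paths are cadlag, all integrals are limits of left-endpoint Riemann sums, so every iterate
  is adapted. The variation is a countable supremum of grid sums, so \<open>\<tau>\<close>, the infimum of the
  rational times at which one of the smallness conditions fails, is a Markov time.
\<close>

section \<open>Total variation\<close>

text \<open>The square root is not Lipschitz at 0, so a contraction argument works only away from 0.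
  The statement asks for nothing more than some positive Markov time, and since r0 > 0 the time can
  be chosen so that the path never comes near 0. Three points shape the proof.
  \<open>\<Gamma>\<^sub>4\<close> may jump infinitely often in every interval, so it is not obvious
  that its variation over [0, t] vanishes as t decreases to 0; this is why right-continuity has to
  be transferred from a path to its variation. The variance may vanish, but sqrt (V r) = sqrt V *
  sqrt r, so an upper bound on V controls the Lipschitz constant of the mixed term. Finally, the
  bound V0 + 1 and r0 are deterministic, so one deterministic \<epsilon> serves all outcomes and the
  smallness conditions are measurable events. The infimum of rational failure times gives access to
  the event of failing strictly before t; right-continuity of the augmented filtration closes the
  gap to a Markov time.\<close>

text \<open>Increments of \<open>f\<close> add up across adjacent intervals, so \<open>?f\<close> is
  an operative interval function, whose sum over a division is its value on the whole
  interval.\<close>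

lemma additive_division_1:
  fixes f :: "real \<Rightarrow> real"
  assumes "a \<le> b" and "d division_of {a..b}"
  shows "(\<Sum>K\<in>d. f (Sup K) - f (Inf K)) = f b - f a"
proof -
  let ?f = "(\<lambda>K::real set. if K = {} then 0 else f (interval_upperbound K) - f (interval_lowerbound K))"
  interpret operative_real plus 0 ?f
    rewrites "comm_monoid_set.F (+) 0 = sum"
    by standard[1] (auto simp add: sum_def)
  have "sum ?f d = ?f {a..b}"
    using division[of d a b] assms by simp
  moreover have "sum ?f d = (\<Sum>K\<in>d. f (Sup K) - f (Inf K))"
    by (rule sum.cong) (use division_ofD(3,4)[OF assms(2)] in \<open>fastforce simp: interval_bounds_real\<close>)+
  ultimately show ?thesis using assms(1) by simp
qed

text \<open>Termwise domination reduces the sum to increments of \<open>U\<close>, which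
  telescope.\<close>

lemma variation_sums_le:
  assumes "a \<le> b" and "\<And>s t. a \<le> s \<Longrightarrow> s \<le> t \<Longrightarrow> t \<le> b \<Longrightarrow> \<bar>f t - f s\<bar> \<le> U t - U s"
    and "x \<in> variation_sums f a b"
  shows "x \<le> U b - U a"
proof -
  obtain d where d: "d division_of {a..b}" and x: "x = (\<Sum>K\<in>d. \<bar>f (Sup K) - f (Inf K)\<bar>)"
    using assms(3) by (auto simp: variation_sums_def)
  have "x \<le> (\<Sum>K\<in>d. U (Sup K) - U (Inf K))"
    unfolding x
  proof (rule sum_mono)
    fix K assume K: "K \<in> d"
    then obtain p q where pq: "K = {p..q}" "K \<noteq> {}" "K \<subseteq> {a..b}"
      using division_ofD(2,3,4)[OF d K] by (metis cbox_interval)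
    then show "\<bar>f (Sup K) - f (Inf K)\<bar> \<le> U (Sup K) - U (Inf K)"
      using assms(2)[of p q] by auto
  qed
  also have "\<dots> = U b - U a"
    by (rule additive_division_1[OF assms(1) d])
  finally show ?thesis .
qed

lemma division_of_self_interval: "(a::real) \<le> b \<Longrightarrow> {{a..b}} division_of {a..b}"
  using division_of_self[of a b] by simp

lemma total_variation_le:
  assumes "a \<le> b" and "\<And>s t. a \<le> s \<Longrightarrow> s \<le> t \<Longrightarrow> t \<le> b \<Longrightarrow> \<bar>f t - f s\<bar> \<le> U t - U s"
  shows "total_variation f a b \<le> U b - U a"
  unfolding total_variation_def
proof (rule cSup_least)
  show "variation_sums f a b \<noteq> {}"
    using division_of_self_interval[OF assms(1)] by (auto simp: variation_sums_def)
qed (rule variation_sums_le[OF assms])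

lemma total_variation_self [simp]: "total_variation f a a = 0"
proof -
  have "variation_sums f a a = {0}"
  proof
    show "variation_sums f a a \<subseteq> {0}"
    proof
      fix x assume "x \<in> variation_sums f a a"
      then obtain d where d: "d division_of {a..a}" and x: "x = (\<Sum>K\<in>d. \<bar>f (Sup K) - f (Inf K)\<bar>)"
        by (auto simp: variation_sums_def)
      have K: "K = {a}" if "K \<in> d" for K
        using division_ofD(2,3)[OF d that] by auto
      have "\<bar>f (Sup K) - f (Inf K)\<bar> = 0" if "K \<in> d" for K
        by (simp add: K[OF that])
      then show "x \<in> {0}" unfolding x by simp
    qed
    show "{0} \<subseteq> variation_sums f a a"
    proof -
      have "(\<Sum>K\<in>{{a..a}}. \<bar>f (Sup K) - f (Inf K)\<bar>) \<in> variation_sums f a a"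
        using division_of_self_interval[of a a] unfolding variation_sums_def by blast
      then show ?thesis by simp
    qed
  qed
  then show ?thesis by (simp add: total_variation_def)
qed

text \<open>Adjoining the last interval to any division of the earlier part gives a division of the
  whole. Moved to one side, this makes the variation itself a function that dominates the increments
  of \<open>f\<close>.\<close>

lemma total_variation_add_increment:
  assumes "a \<le> s" "s \<le> t" and bv: "bounded_variation_on f a t"
  shows "total_variation f a s + \<bar>f t - f s\<bar> \<le> total_variation f a t"
proof -
  have "x \<le> total_variation f a t - \<bar>f t - f s\<bar>" if "x \<in> variation_sums f a s" for x
  proof -
    obtain d where d: "d division_of {a..s}" and x: "x = (\<Sum>K\<in>d. \<bar>f (Sup K) - f (Inf K)\<bar>)"
      using \<open>x \<in> _\<close> by (auto simp: variation_sums_def)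
    let ?w = "\<lambda>K. \<bar>f (Sup K) - f (Inf K)\<bar>"
    have "(d \<union> {{s..t}}) division_of ({a..s} \<union> {s..t})"
      by (intro division_disjoint_union d division_of_self_interval assms) auto
    moreover have "{a..s} \<union> {s..t} = {a..t}" using assms by auto
    ultimately have "sum ?w (d \<union> {{s..t}}) \<in> variation_sums f a t"
      by (auto simp: variation_sums_def)
    then have "sum ?w (d \<union> {{s..t}}) \<le> total_variation f a t"
      using bv unfolding total_variation_def bounded_variation_on_def by (rule cSup_upper)
    \<comment> \<open>A division is a set, so the new interval may already belong to
      \<open>d\<close>; this forces \<open>s = t\<close>, and then its term is 0.\<close>
    moreover have "sum ?w (d \<union> {{s..t}}) = x + ?w {s..t}"
    proof (cases "{s..t} \<in> d")
      case True
      then have "{s..t} \<subseteq> {a..s}" using division_ofD(2)[OF d] by blast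
      then have "s = t" using assms by auto
      then show ?thesis using True x by (simp add: insert_absorb)
    next
      case False
      then show ?thesis using x division_ofD(1)[OF d] by simp
    qed
    ultimately show ?thesis using assms by simp
  qed
  then have "total_variation f a s \<le> total_variation f a t - \<bar>f t - f s\<bar>"
    unfolding total_variation_def[of f a s]
    by (intro cSup_least)
      (use division_of_self_interval[OF assms(1)] in \<open>auto simp: variation_sums_def\<close>)
  then show ?thesis by simp
qed

text \<open>The total variation is the least function dominating the increments of \<open>f\<close>. Replacing it
  by its right limits beyond \<open>s\<close> yields a function that still dominates them.\<close>

lemma total_variation_right_continuous:
  assumes bv: "\<And>t. 0 \<le> t \<Longrightarrow> bounded_variation_on f 0 t"
    and rc: "\<And>t. 0 \<le> t \<Longrightarrow> (f \<longlongrightarrow> f t) (at_right t)"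
    and s: "0 \<le> s"
  shows "(total_variation f 0 \<longlongrightarrow> total_variation f 0 s) (at_right s)"
proof -
  define TV where "TV = total_variation f 0"
  define R where "R t = (INF u\<in>{t<..}. TV u)" for t
  have incr: "\<bar>f t - f s\<bar> \<le> TV t - TV s" if "0 \<le> s" "s \<le> t" for s t
    using total_variation_add_increment[OF that bv] that by (simp add: TV_def)
  have mono: "TV s \<le> TV t" if "0 \<le> s" "s \<le> t" for s t
    using incr[OF that] by linarith
  have nonneg: "0 \<le> TV t" if "0 \<le> t" for t
    using mono[of 0 t] that by (simp add: TV_def)
  have lim: "(TV \<longlongrightarrow> R t) (at_right t)" if t: "0 \<le> t" for t
  proof (rule order_tendstoI)
    have bdd: "bdd_below (TV ` {t<..})"
      using nonneg t by (intro bdd_belowI[of _ 0]) force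
    fix c assume "c < R t"
    then have "c < TV u" if "t < u" for u
      using cINF_lower[OF bdd, of u] that by (auto simp: R_def)
    then show "\<forall>\<^sub>F u in at_right t. c < TV u"
      by (auto intro: eventually_at_right_less[THEN eventually_mono])
  next
    fix c assume "R t < c"
    moreover have bdd: "bdd_below (TV ` {t<..})"
      using nonneg t by (intro bdd_belowI[of _ 0]) force
    ultimately obtain w where w: "t < w" "TV w < c"
      unfolding R_def by (subst (asm) cINF_less_iff) auto
    have "TV u < c" if "t < u" "u < w" for u
      using mono[of u w] w that t by linarith
    then show "\<forall>\<^sub>F u in at_right t. TV u < c"
      using w(1) unfolding eventually_at_right_field by blast
  qed
  have R_incr: "\<bar>f t - f s\<bar> \<le> R t - R s" if st: "0 \<le> s" "s \<le> t" for s t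
  proof -
    have *: "\<bar>f t - f s\<bar> \<le> R t - R s" if "s < t" for t
    proof -
      have "\<bar>f u - f s\<bar> \<le> TV u - R s" if "s < u" for u
      proof (rule tendsto_le[of "at_right s"])
        show "((\<lambda>w. \<bar>f u - f w\<bar>) \<longlongrightarrow> \<bar>f u - f s\<bar>) (at_right s)"
          by (intro tendsto_intros rc st)
        show "((\<lambda>w. TV u - TV w) \<longlongrightarrow> TV u - R s) (at_right s)"
          by (intro tendsto_intros lim st)
        show "\<forall>\<^sub>F w in at_right s. \<bar>f u - f w\<bar> \<le> TV u - TV w"
          unfolding eventually_at_right_field using that st incr by (intro exI[of _ u]) auto
      qed simp
      note * = this
      show ?thesis
      proof (rule tendsto_le[of "at_right t"])
        show "((\<lambda>u. \<bar>f u - f s\<bar>) \<longlongrightarrow> \<bar>f t - f s\<bar>) (at_right t)"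
          using that st by (intro tendsto_intros rc) auto
        show "((\<lambda>u. TV u - R s) \<longlongrightarrow> R t - R s) (at_right t)"
          using that st by (intro tendsto_intros lim) auto
        show "\<forall>\<^sub>F u in at_right t. \<bar>f u - f s\<bar> \<le> TV u - R s"
          unfolding eventually_at_right_field using that by (intro exI[of _ "t+1"]) (auto intro!: *)
      qed simp
    qed
    show ?thesis using *[of t] st by (cases "s = t") auto
  qed
  have le: "TV t \<le> TV s + (R t - R s)" if "s < t" for t
  proof -
    \<comment> \<open>\<open>U\<close> is \<open>TV\<close> with its possible right jump
      \<open>R s - TV s\<close> at \<open>s\<close> cut out. Minimality of \<open>TV\<close> among
      dominating functions will force that jump to be 0.\<close>
    define U where "U u = (if u \<le> s then TV u else TV s + (R u - R s))" for u
    have "\<bar>f w - f u\<bar> \<le> U w - U u" if "0 \<le> u" "u \<le> w" for u w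
    proof -
      consider "w \<le> s" | "s < u" | "u \<le> s" "s < w" by linarith
      then show ?thesis
      proof cases
        case 3
        then show ?thesis using incr[of u s] R_incr[of s w] that s by (simp add: U_def)
      qed (use incr[OF that] R_incr[OF that] that in \<open>auto simp: U_def\<close>)
    qed
    then have "TV t \<le> U t - U 0"
      unfolding TV_def using that s by (intro total_variation_le) auto
    then show ?thesis using that s by (simp add: U_def TV_def)
  qed
  have R_le: "R t \<le> TV w" if "0 \<le> t" "t < w" for t w
    unfolding R_def using that nonneg
    by (intro cINF_lower bdd_belowI[of _ 0]) (auto intro: order_trans)
  \<comment> \<open>Letting \<open>t\<close> decrease to \<open>s\<close> in \<open>le\<close>
    directly would require right-continuity of \<open>R\<close>. Bounding \<open>R t\<close> by
    \<open>TV w\<close> for a second point \<open>w > t\<close> avoids this; afterwards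
    \<open>w\<close> decreases to \<open>s\<close> as well.\<close>
  have "2 * R s \<le> TV s + TV w" if "s < w" for w
  proof (rule tendsto_upperbound)
    show "((\<lambda>t. TV t + R s) \<longlongrightarrow> 2 * R s) (at_right s)"
      using tendsto_add[OF lim[OF s] tendsto_const[of "R s"]] by simp
    have "TV t + R s \<le> TV s + TV w" if "s < t" "t < w" for t
      using le[of t] R_le[of t w] that s by linarith
    then show "\<forall>\<^sub>F t in at_right s. TV t + R s \<le> TV s + TV w"
      unfolding eventually_at_right_field using \<open>s < w\<close> by blast
  qed simp
  then have "2 * R s \<le> TV s + R s"
    by (intro tendsto_lowerbound[OF tendsto_add[OF tendsto_const lim[OF s]]])
      (auto intro: eventually_at_right_less[THEN eventually_mono])
  moreover have "TV s \<le> R s"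
    using mono s unfolding R_def by (intro cINF_greatest) auto
  ultimately have "R s = TV s" by simp
  then show ?thesis using lim[OF s] by (simp add: TV_def)
qed

section \<open>Uniform grids and grid sums of the variation\<close>

definition grid :: "real \<Rightarrow> nat \<Rightarrow> nat \<Rightarrow> real"
  where "grid t n j = t * real j / real (Suc n)"

text \<open>Rounding goes up: the paths are right-continuous, so the value at \<open>s\<close> is
  approximated from grid points at or after \<open>s\<close>.\<close>

definition grid_index :: "real \<Rightarrow> nat \<Rightarrow> real \<Rightarrow> nat"
  where "grid_index t n s = nat \<lceil>s * real (Suc n) / t\<rceil>"

lemma grid_0 [simp]: "grid t n 0 = 0" and grid_0_left [simp]: "grid 0 n j = 0"
  and grid_Suc [simp]: "grid t n (Suc n) = t"
  by (simp_all add: grid_def del: of_nat_Suc)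

lemma grid_nonneg: "0 \<le> t \<Longrightarrow> 0 \<le> grid t n j"
  by (simp add: grid_def)

lemma grid_mono: "0 \<le> t \<Longrightarrow> i \<le> j \<Longrightarrow> grid t n i \<le> grid t n j"
  by (simp add: grid_def divide_right_mono mult_left_mono)

lemma grid_less: "0 < t \<Longrightarrow> j < Suc n \<Longrightarrow> grid t n j < t"
  by (simp add: grid_def field_simps del: of_nat_Suc)

lemma grid_le: "0 \<le> t \<Longrightarrow> j \<le> Suc n \<Longrightarrow> grid t n j \<le> t"
  using grid_mono[of t j "Suc n" n] by simp

lemma grid_index_Suc [simp]: "0 < t \<Longrightarrow> grid_index t n t = Suc n" "grid_index t n 0 = 0"
  by (simp_all add: grid_index_def del: of_nat_Suc)

lemma grid_index_mono: "0 < t \<Longrightarrow> r \<le> s \<Longrightarrow> grid_index t n r \<le> grid_index t n s"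
  unfolding grid_index_def by (intro nat_mono ceiling_mono divide_right_mono mult_right_mono) auto

lemma grid_grid_index:
  assumes "0 < t" "0 \<le> s"
  shows "s \<le> grid t n (grid_index t n s)" "grid t n (grid_index t n s) < s + t / real (Suc n)"
proof -
  let ?u = "s * real (Suc n) / t"
  have "0 \<le> ?u" using assms by simp
  then have r: "real (grid_index t n s) = of_int \<lceil>?u\<rceil>"
    unfolding grid_index_def by (metis ceiling_mono ceiling_zero of_nat_nat)
  have "t * ?u / real (Suc n) \<le> grid t n (grid_index t n s)"
    unfolding grid_def r using assms by (intro divide_right_mono mult_left_mono) auto
  then show "s \<le> grid t n (grid_index t n s)" using assms by (simp del: of_nat_Suc)
  have "of_int \<lceil>?u\<rceil> < ?u + 1" by linarith
  then have "grid t n (grid_index t n s) < t * (?u + 1) / real (Suc n)"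
    unfolding grid_def r using assms by (intro divide_strict_right_mono mult_strict_left_mono) auto
  then show "grid t n (grid_index t n s) < s + t / real (Suc n)"
    using assms by (simp add: distrib_left add_divide_distrib del: of_nat_Suc)
qed

lemma sum_grid_diff: "(\<Sum>j<Suc n. f (grid t n (Suc j)) - f (grid t n j)) = f t - f (0::real)"
  for f :: "real \<Rightarrow> real"
  using sum_lessThan_telescope[of "\<lambda>j. f (grid t n j)" "Suc n"] by simp

lemma grid_variation_le:
  assumes "0 \<le> t" and bv: "\<And>s. 0 \<le> s \<Longrightarrow> bounded_variation_on f 0 s"
  shows "(\<Sum>j<Suc n. \<bar>f (grid t n (Suc j)) - f (grid t n j)\<bar>) \<le> total_variation f 0 t"
proof -
  have "(\<Sum>j<Suc n. \<bar>f (grid t n (Suc j)) - f (grid t n j)\<bar>)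
      \<le> (\<Sum>j<Suc n. total_variation f 0 (grid t n (Suc j)) - total_variation f 0 (grid t n j))"
  proof (rule sum_mono)
    fix j assume "j \<in> {..<Suc n}"
    then have "bounded_variation_on f 0 (grid t n (Suc j))"
      using grid_nonneg[OF assms(1)] by (intro bv) auto
    then show "\<bar>f (grid t n (Suc j)) - f (grid t n j)\<bar>
        \<le> total_variation f 0 (grid t n (Suc j)) - total_variation f 0 (grid t n j)"
      using total_variation_add_increment[of 0 "grid t n j" "grid t n (Suc j)" f]
        grid_nonneg[OF assms(1)] grid_mono[OF assms(1), of j "Suc j"] by simp
  qed
  then show ?thesis by (simp only: sum_grid_diff total_variation_self)
qed

text \<open>Rounding up to the grid turns any division into one that the grid sum dominates.\<close>

lemma total_variation_le_grid:
  assumes t: "0 < t" and rc: "\<And>s. 0 \<le> s \<Longrightarrow> (f \<longlongrightarrow> f s) (at_right s)"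
    and le: "\<And>n. (\<Sum>j<Suc n. \<bar>f (grid t n (Suc j)) - f (grid t n j)\<bar>) \<le> c"
  shows "total_variation f 0 t \<le> c"
  unfolding total_variation_def
proof (rule cSup_least)
  show "variation_sums f 0 t \<noteq> {}"
    using division_of_self_interval[of 0 t] t by (auto simp: variation_sums_def)
next
  fix x assume "x \<in> variation_sums f 0 t"
  then obtain d where d: "d division_of {0..t}" and x: "x = (\<Sum>K\<in>d. \<bar>f (Sup K) - f (Inf K)\<bar>)"
    by (auto simp: variation_sums_def)
  define f' where "f' n s = f (grid t n (grid_index t n s))" for n s
  have conv: "(\<lambda>n. f' n s) \<longlonglongrightarrow> f s" if s: "0 \<le> s" for s
  proof -
    \<comment> \<open>The rounded point may be \<open>s\<close> itself, so continuity within the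
      closed half-line is used instead of the limit along \<open>at_right s\<close>.\<close>
    have "(f \<longlongrightarrow> f s) (at s within {s..})"
      using rc[OF s] by (simp add: at_within_Ici_at_right tendsto_within_subset)
    moreover have "filterlim (\<lambda>n. grid t n (grid_index t n s)) (nhds s) sequentially"
    proof (rule tendsto_sandwich[OF _ _ tendsto_const])
      show "\<forall>\<^sub>F n in sequentially. s \<le> grid t n (grid_index t n s)"
        using grid_grid_index(1)[OF t s] by simp
      show "\<forall>\<^sub>F n in sequentially. grid t n (grid_index t n s) \<le> s + t * inverse (real (Suc n))"
        using grid_grid_index(2)[OF t s] by (intro always_eventually) (simp add: less_imp_le field_simps)
      show "(\<lambda>n. s + t * inverse (real (Suc n))) \<longlonglongrightarrow> s"
        using tendsto_add[OF tendsto_const[of s] tendsto_mult[OF tendsto_const[of t] LIMSEQ_inverse_real_of_nat]] by simp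
    qed
    ultimately show ?thesis
      unfolding f'_def using grid_grid_index(1)[OF t s]
      by (auto intro!: continuous_within_tendsto_compose'[of s "{s..}" f] simp: continuous_within)
  qed
  show "x \<le> c"
  proof (rule tendsto_upperbound)
    show "(\<lambda>n. \<Sum>K\<in>d. \<bar>f' n (Sup K) - f' n (Inf K)\<bar>) \<longlonglongrightarrow> x"
      unfolding x
    proof (intro tendsto_intros conv)
      fix K assume K: "K \<in> d"
      then obtain p q where "K = {p..q}" "K \<noteq> {}" "K \<subseteq> {0..t}"
        using division_ofD(2,3,4)[OF d K] by (metis cbox_interval)
      then show "0 \<le> Sup K" "0 \<le> Inf K" by auto
    qed
    show "\<forall>\<^sub>F n in sequentially. (\<Sum>K\<in>d. \<bar>f' n (Sup K) - f' n (Inf K)\<bar>) \<le> c"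
    proof (intro always_eventually allI)
      fix n
      \<comment> \<open>The running variation along the grid. The rounded path \<open>f' n\<close>
        takes only grid values, so \<open>U\<close> at the grid index dominates its increments, and
        a sum over any division is at most one full grid sum.\<close>
      define U where "U i = (\<Sum>j<i. \<bar>f (grid t n (Suc j)) - f (grid t n j)\<bar>)" for i
      have *: "\<bar>f (grid t n k) - f (grid t n i)\<bar> \<le> U k - U i" if "i \<le> k" for i k
        using that by (induction k rule: dec_induct) (auto simp: U_def)
      have "(\<Sum>K\<in>d. \<bar>f' n (Sup K) - f' n (Inf K)\<bar>) \<le> U (grid_index t n t) - U (grid_index t n 0)"
      proof (rule variation_sums_le[where U = "\<lambda>s. U (grid_index t n s)" and f = "f' n"])
        show "(\<Sum>K\<in>d. \<bar>f' n (Sup K) - f' n (Inf K)\<bar>) \<in> variation_sums (f' n) 0 t"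
          using d by (auto simp: variation_sums_def)
      qed (use t grid_index_mono[OF t] in \<open>auto simp: f'_def intro!: *\<close>)
      also have "\<dots> \<le> c" using le[of n] t by (simp add: U_def)
      finally show "(\<Sum>K\<in>d. \<bar>f' n (Sup K) - f' n (Inf K)\<bar>) \<le> c" .
    qed
  qed simp
qed

section \<open>Left-endpoint Riemann--Stieltjes sums\<close>

definition has_left_lims :: "real \<Rightarrow> (real \<Rightarrow> real) \<Rightarrow> bool"
  where "has_left_lims t f \<longleftrightarrow> (\<forall>s\<in>{0<..t}. \<exists>l. (f \<longlongrightarrow> l) (at_left s))"

lemma tendsto_left_lim: "has_left_lims t f \<Longrightarrow> s \<in> {0<..t} \<Longrightarrow> (f \<longlongrightarrow> left_lim f s) (at_left s)"
  unfolding has_left_lims_def left_lim_def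
  by (metis tendsto_Lim trivial_limit_at_left_real)

lemma left_limI: "(f \<longlongrightarrow> l) (at_left s) \<Longrightarrow> left_lim f s = l" for f :: "real \<Rightarrow> real"
  unfolding left_lim_def by (intro tendsto_Lim) auto

lemma eventually_at_left_ge0: "0 < s \<Longrightarrow> (\<And>u. 0 \<le> u \<Longrightarrow> u < s \<Longrightarrow> P u) \<Longrightarrow> eventually P (at_left (s::real))"
  unfolding eventually_at_left_field by (intro exI[of _ 0]) auto

lemma left_lim_mem:
  assumes "has_left_lims t f" "s \<in> {0<..t}" "closed C" "\<And>u. u \<in> {0..<s} \<Longrightarrow> f u \<in> C"
  shows "left_lim f s \<in> C"
  using tendsto_left_lim[OF assms(1,2)] assms
  by (intro Lim_in_closed_set[OF assms(3) _ _ tendsto_left_lim[OF assms(1,2)]]) (auto intro!: eventually_at_left_ge0)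

lemma abs_left_lim_le:
  assumes "has_left_lims t f" "s \<in> {0<..t}" "\<And>u. u \<in> {0..<s} \<Longrightarrow> \<bar>f u\<bar> \<le> C"
  shows "\<bar>left_lim f s\<bar> \<le> C"
  using left_lim_mem[OF assms(1,2), of "{-C..C}"] assms(3) by (force simp: abs_le_iff)

lemma has_left_lims_subset: "has_left_lims t f \<Longrightarrow> s \<le> t \<Longrightarrow> has_left_lims s f"
  unfolding has_left_lims_def by auto

text \<open>The cells are open on the left, so the value at \<open>s\<close> is \<open>f\<close> at
  a grid point strictly before \<open>s\<close>. This is why refinement leads to the left limit and
  not to \<open>f s\<close>.\<close>

definition step_approx :: "real \<Rightarrow> (real \<Rightarrow> real) \<Rightarrow> nat \<Rightarrow> real \<Rightarrow> real"
  where "step_approx t f n s =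
    (\<Sum>j<Suc n. f (grid t n j) * indicator {grid t n j<..grid t n (Suc j)} s)"

lemma step_approx_eq:
  assumes "j < Suc n" "s \<in> {grid t n j<..grid t n (Suc j)}" "0 < t"
  shows "step_approx t f n s = f (grid t n j)"
proof -
  have "indicator {grid t n i<..grid t n (Suc i)} s = (0::real)" if "i \<noteq> j" for i
    using that grid_mono[of t "Suc i" j n] grid_mono[of t "Suc j" i n] assms
    by (cases "i < j") (auto simp: indicator_def not_less_eq_eq dest!: Suc_leI)
  then have "step_approx t f n s = (\<Sum>i<Suc n. if i = j then f (grid t n j) else 0)"
    unfolding step_approx_def using assms(2) by (intro sum.cong) auto
  then show ?thesis using assms(1) by simp
qed

text \<open>The cell index is the rounded-up index minus one, again because the cells are open on
  the left.\<close>

lemma grid_cell: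
  assumes "0 < t" "s \<in> {0<..t}"
  obtains j where "j < Suc n" "s \<in> {grid t n j<..grid t n (Suc j)}" "s - t / real (Suc n) \<le> grid t n j"
proof -
  let ?u = "s * real (Suc n) / t"
  let ?i = "grid_index t n s"
  have u: "0 < ?u" using assms by simp
  then have r: "real ?i = of_int \<lceil>?u\<rceil>"
    unfolding grid_index_def by (metis ceiling_mono ceiling_zero of_nat_nat less_imp_le)
  have "0 < \<lceil>?u\<rceil>" using u by (simp only: zero_less_ceiling)
  then have "?i \<noteq> 0" unfolding grid_index_def by linarith
  then obtain j where j: "?i = Suc j" by (cases ?i) auto
  have "?i \<le> Suc n"
    using grid_index_mono[OF assms(1), of s t n] assms by simp
  moreover have "real j < ?u"
    using r j by (simp del: of_nat_Suc) linarith
  then have "grid t n j < s" using assms(1) by (simp add: grid_def field_simps del: of_nat_Suc)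
  moreover have "s \<le> grid t n (Suc j)"
    using grid_grid_index(1)[OF assms(1), of s n] assms j by simp
  moreover have "grid t n (Suc j) = grid t n j + t / real (Suc n)"
    unfolding grid_def by (simp add: add_divide_distrib distrib_left)
  ultimately show thesis using that[of j] j by auto
qed

lemma step_approx_tendsto:
  assumes t: "0 < t" and ll: "has_left_lims t f" and s: "s \<in> {0<..t}"
  shows "(\<lambda>n. step_approx t f n s) \<longlonglongrightarrow> left_lim f s"
proof -
  have "\<exists>j. j < Suc n \<and> s \<in> {grid t n j<..grid t n (Suc j)} \<and> s - t / real (Suc n) \<le> grid t n j" for n
    using grid_cell[OF t s] by metis
  then obtain J where J: "J n < Suc n" "s \<in> {grid t n (J n)<..grid t n (Suc (J n))}"
    "s - t / real (Suc n) \<le> grid t n (J n)" for n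
    by metis
  have "(\<lambda>n. grid t n (J n)) \<longlonglongrightarrow> s"
  proof (rule tendsto_sandwich[OF _ _ _ tendsto_const])
    show "(\<lambda>n. s - t * inverse (real (Suc n))) \<longlonglongrightarrow> s"
      using tendsto_diff[OF tendsto_const[of s] tendsto_mult[OF tendsto_const[of t] LIMSEQ_inverse_real_of_nat]] by simp
    show "\<forall>\<^sub>F n in sequentially. s - t * inverse (real (Suc n)) \<le> grid t n (J n)"
      using J(3) by (intro always_eventually) (simp add: field_simps)
    show "\<forall>\<^sub>F n in sequentially. grid t n (J n) \<le> s"
      using J(2) by (intro always_eventually) (auto intro: less_imp_le)
  qed
  then have "filterlim (\<lambda>n. grid t n (J n)) (at_left s) sequentially"
    unfolding filterlim_at using J(2) by (auto intro!: always_eventually simp: less_imp_neq)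
  then have "(\<lambda>n. f (grid t n (J n))) \<longlonglongrightarrow> left_lim f s"
    by (rule filterlim_compose[OF tendsto_left_lim[OF ll s]])
  then show ?thesis using step_approx_eq[OF J(1,2) t] by simp
qed

text \<open>Three integrators are treated at once: the identity, which yields Lebesgue measure, and
  the positive and negative variation of a path.\<close>

locale stieltjes_measure =
  fixes m :: "real \<Rightarrow> real"
  assumes m_mono: "x \<le> y \<Longrightarrow> m x \<le> m y"
    and m_right_cont: "continuous (at_right a) m"
begin

abbreviation "\<mu> \<equiv> interval_measure m"

lemma emeasure_Ioc: "a \<le> b \<Longrightarrow> emeasure \<mu> {a<..b} = ennreal (m b - m a)"
  by (rule emeasure_interval_measure_Ioc[OF _ m_mono m_right_cont])

lemma measure_Ioc: "a \<le> b \<Longrightarrow> measure \<mu> {a<..b} = m b - m a"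
  by (rule measure_interval_measure_Ioc[OF _ m_mono m_right_cont])

text \<open>The Riemann sums are the integrals of \<open>step_approx\<close>, and dominated
  convergence with a constant bound on a set of finite measure gives their limit. Measurability of
  \<open>left_lim f\<close> on the interval comes out of the same pointwise limit of step
  functions.\<close>

lemma left_lim_integral:
  assumes t: "0 \<le> t" and ll: "has_left_lims t f" and C: "\<And>s. s \<in> {0..<t} \<Longrightarrow> \<bar>f s\<bar> \<le> C"
  shows "set_integrable \<mu> {0<..t} (left_lim f)" (is ?int)
    and "(\<lambda>n. \<Sum>j<Suc n. f (grid t n j) * (m (grid t n (Suc j)) - m (grid t n j)))
      \<longlonglongrightarrow> (LINT s:{0<..t}|\<mu>. left_lim f s)" (is "?sums \<longlonglongrightarrow> ?I")
proof -
  have "?int \<and> (?sums \<longlonglongrightarrow> ?I)"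
  proof (cases "t = 0")
    case True
    then show ?thesis by (simp add: set_integrable_def set_lebesgue_integral_def)
  next
    case False
    with t have t: "0 < t" by simp
    let ?g = "\<lambda>s. indicator {0<..t} s * left_lim f s"
    have cells: "{grid t n j<..grid t n (Suc j)} \<subseteq> {0<..t}" if "j < Suc n" for n j
      using grid_nonneg[of t n j] grid_le[of t "Suc j" n] that t by auto
    have outside: "step_approx t f n s = 0" if "s \<notin> {0<..t}" for n s
    proof -
      have "indicator {grid t n j<..grid t n (Suc j)} s = (0::real)" if "j < Suc n" for j
        using cells[OF that] \<open>s \<notin> _\<close> by (meson indicator_simps(2) subsetD)
      then show ?thesis unfolding step_approx_def by (intro sum.neutral) simp
    qed
    have conv: "(\<lambda>n. step_approx t f n s) \<longlonglongrightarrow> ?g s" for s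
    proof (cases "s \<in> {0<..t}")
      case True
      then show ?thesis using step_approx_tendsto[OF t ll] by simp
    next
      case False
      then have "step_approx t f n s = 0" for n using outside by simp
      then show ?thesis using False by simp
    qed
    have meas: "step_approx t f n \<in> borel_measurable \<mu>" for n
      unfolding step_approx_def by measurable
    have fin: "emeasure \<mu> {0<..t} < \<infinity>" using t by (simp add: emeasure_Ioc)
    have dom: "integrable \<mu> (\<lambda>s. C * indicator {0<..t} s)"
      using fin by (intro integrable_mult_right integrable_real_indicator) auto
    have bound: "norm (step_approx t f n s) \<le> C * indicator {0<..t} s" for n s
    proof (cases "s \<in> {0<..t}")
      case True
      obtain j where j: "j < Suc n" "s \<in> {grid t n j<..grid t n (Suc j)}"
        using grid_cell[OF t True] by metis
      then have "grid t n j \<in> {0..<t}" using grid_nonneg grid_less t by auto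
      then show ?thesis using True C step_approx_eq[OF j t] by simp
    next
      case False
      then have "step_approx t f n s = 0" using outside by simp
      then show ?thesis using False by simp
    qed
    have meas_g: "?g \<in> borel_measurable \<mu>"
      by (rule borel_measurable_LIMSEQ_real[OF conv meas])
    note dc = integrable_dominated_convergence[OF meas_g meas dom AE_I2[OF conv] AE_I2[OF bound]]
      integral_dominated_convergence[OF meas_g meas dom AE_I2[OF conv] AE_I2[OF bound]]
    have "(LINT s|\<mu>. step_approx t f n s) =
        (\<Sum>j<Suc n. f (grid t n j) * (m (grid t n (Suc j)) - m (grid t n j)))" for n
    proof -
      have "(LINT s|\<mu>. step_approx t f n s) =
          (\<Sum>j<Suc n. LINT s|\<mu>. f (grid t n j) * indicator {grid t n j<..grid t n (Suc j)} s)"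
        unfolding step_approx_def using t
        by (intro Bochner_Integration.integral_sum integrable_mult_right integrable_real_indicator)
          (simp_all add: emeasure_Ioc grid_mono)
      also have "\<dots> = (\<Sum>j<Suc n. f (grid t n j) * (m (grid t n (Suc j)) - m (grid t n j)))"
        using t by (intro sum.cong) (simp_all add: measure_Ioc grid_mono)
      finally show ?thesis .
    qed
    with dc show ?thesis
      by (simp add: set_integrable_def set_lebesgue_integral_def)
  qed
  then show ?int "?sums \<longlonglongrightarrow> ?I" by blast+
qed

lemma left_lim_integral_increment:
  assumes st: "0 \<le> s" "s \<le> t" and ll: "has_left_lims t f" and C: "\<And>s. s \<in> {0..<t} \<Longrightarrow> \<bar>f s\<bar> \<le> C"
  shows "\<bar>(LINT u:{0<..t}|\<mu>. left_lim f u) - (LINT u:{0<..s}|\<mu>. left_lim f u)\<bar> \<le> C * (m t - m s)"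
proof -
  have int: "set_integrable \<mu> {0<..t} (left_lim f)"
    using left_lim_integral(1)[OF _ ll C] st by simp
  have ints: "set_integrable \<mu> {0<..s} (left_lim f)" "set_integrable \<mu> {s<..t} (left_lim f)"
    by (rule set_integrable_subset[OF int]; use st in auto)+
  have "{0<..t} = {0<..s} \<union> {s<..t}" using st by auto
  then have "(LINT u:{0<..t}|\<mu>. left_lim f u) - (LINT u:{0<..s}|\<mu>. left_lim f u) = (LINT u:{s<..t}|\<mu>. left_lim f u)"
    using set_integral_Un[OF _ ints] by simp
  also have "\<bar>\<dots>\<bar> \<le> (LINT u|\<mu>. C * indicator {s<..t} u)"
    unfolding set_lebesgue_integral_def real_norm_def[symmetric]
  proof (rule Bochner_Integration.integral_norm_bound_integral)
    show "integrable \<mu> (\<lambda>u. indicator {s<..t} u *\<^sub>R left_lim f u)"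
      using ints(2) by (simp add: set_integrable_def)
    show "integrable \<mu> (\<lambda>u. C * indicator {s<..t} u)"
      using st by (intro integrable_mult_right integrable_real_indicator) (auto simp: emeasure_Ioc)
    show "norm (indicator {s<..t} u *\<^sub>R left_lim f u) \<le> C * indicator {s<..t} u" for u
      using abs_left_lim_le[OF ll, of u C] C st by (auto simp: indicator_def)
  qed
  also have "\<dots> = C * (m t - m s)" using st by (simp add: measure_Ioc)
  finally show ?thesis .
qed

end

lemma stieltjes_measure_id: "stieltjes_measure (\<lambda>x. x)"
  by unfold_locales auto

text \<open>The functions \<open>pos_variation G\<close> and \<open>neg_variation G\<close> are right-continuous only because the
  total variation inherits right-continuity from \<open>G\<close>.\<close>

locale bv_integrator =
  fixes G :: "real \<Rightarrow> real"
  assumes bv: "0 \<le> t \<Longrightarrow> bounded_variation_on G 0 t"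
    and right_cont: "0 \<le> t \<Longrightarrow> (G \<longlongrightarrow> G t) (at_right t)"
begin

abbreviation "TV \<equiv> total_variation G 0"

lemma TV_increment: "0 \<le> s \<Longrightarrow> s \<le> t \<Longrightarrow> \<bar>G t - G s\<bar> \<le> TV t - TV s"
  using total_variation_add_increment[OF _ _ bv, of s t] by simp

lemma TV_right_cont: "0 \<le> t \<Longrightarrow> (TV \<longlongrightarrow> TV t) (at_right t)"
  using total_variation_right_continuous[OF bv right_cont] by blast

text \<open>The same extension as in \<open>pos_variation\<close>: constant on negative times, so
  that the Stieltjes measure has no atom at 0 and no mass before it.\<close>

lemma continuous_extend_by_0:
  fixes f :: "real \<Rightarrow> real"
  assumes "\<And>t. 0 \<le> t \<Longrightarrow> (f \<longlongrightarrow> f t) (at_right t)"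
  shows "continuous (at_right a) (\<lambda>s. f (max 0 s))"
proof (cases "0 \<le> a")
  case True
  have "((\<lambda>s. f (max 0 s)) \<longlongrightarrow> f a) (at_right a)"
    by (rule Lim_transform_eventually[OF assms[OF True]])
      (use True in \<open>auto simp: eventually_at_right_field intro!: exI[of _ "a+1"]\<close>)
  then show ?thesis using True by (simp add: continuous_within)
next
  case False
  have "((\<lambda>s. f (max 0 s)) \<longlongrightarrow> f 0) (at_right a)"
    by (rule Lim_transform_eventually[OF tendsto_const])
      (use False in \<open>auto simp: eventually_at_right_field intro!: exI[of _ 0]\<close>)
  then show ?thesis using False by (simp add: continuous_within max_def)
qed

sublocale P: stieltjes_measure "pos_variation G"
proof
  show "pos_variation G x \<le> pos_variation G y" if "x \<le> y" for x y
  proof -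
    have "(Q + (q - z)) / 2 \<le> (P + (p - z)) / 2" if "\<bar>p - q\<bar> \<le> P - Q" for p q P Q z :: real
      using that by (simp add: abs_le_iff)
    from this[OF TV_increment[OF max.cobounded1 max.mono[OF order_refl that]]]
    show ?thesis unfolding pos_variation_def .
  qed
  show "continuous (at_right a) (pos_variation G)" for a
    unfolding pos_variation_def[abs_def]
    by (rule continuous_extend_by_0[of "\<lambda>s. (TV s + (G s - G 0)) / 2"])
      (intro tendsto_intros TV_right_cont right_cont; simp)
qed

sublocale N: stieltjes_measure "neg_variation G"
proof
  show "neg_variation G x \<le> neg_variation G y" if "x \<le> y" for x y
  proof -
    have "(Q - (q - z)) / 2 \<le> (P - (p - z)) / 2" if "\<bar>p - q\<bar> \<le> P - Q" for p q P Q z :: real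
      using that by (simp add: abs_le_iff)
    from this[OF TV_increment[OF max.cobounded1 max.mono[OF order_refl that]]]
    show ?thesis unfolding neg_variation_def .
  qed
  show "continuous (at_right a) (neg_variation G)" for a
    unfolding neg_variation_def[abs_def]
    by (rule continuous_extend_by_0[of "\<lambda>s. (TV s - (G s - G 0)) / 2"])
      (intro tendsto_intros TV_right_cont right_cont; simp)
qed

lemma pos_neg_variation:
  "0 \<le> s \<Longrightarrow> pos_variation G s + neg_variation G s = TV s"
  "0 \<le> s \<Longrightarrow> pos_variation G s - neg_variation G s = G s - G 0"
  by (auto simp: pos_variation_def neg_variation_def field_simps)

text \<open>Subtracting the sums for the two variations leaves sums against \<open>G\<close> itself.
  The integral is thus a limit of expressions in finitely many values of \<open>f\<close> and
  \<open>G\<close>, which later gives its measurability in the outcome.\<close>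

lemma stieltjes_integral_sums:
  assumes t: "0 \<le> t" and ll: "has_left_lims t f" and C: "\<And>s. s \<in> {0..<t} \<Longrightarrow> \<bar>f s\<bar> \<le> C"
  shows "(\<lambda>n. \<Sum>j<Suc n. f (grid t n j) * (G (grid t n (Suc j)) - G (grid t n j)))
      \<longlonglongrightarrow> stieltjes_integral G (left_lim f) t"
proof -
  have "f (grid t n j) * (pos_variation G (grid t n (Suc j)) - pos_variation G (grid t n j))
      - f (grid t n j) * (neg_variation G (grid t n (Suc j)) - neg_variation G (grid t n j))
      = f (grid t n j) * (G (grid t n (Suc j)) - G (grid t n j))" for n j
    using pos_neg_variation(2)[of "grid t n j"] pos_neg_variation(2)[of "grid t n (Suc j)"] grid_nonneg[OF t]
    unfolding right_diff_distrib[symmetric] by (intro arg_cong2[where f="(*)"] refl) (simp add: algebra_simps)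
  then show ?thesis
    using tendsto_diff[OF P.left_lim_integral(2)[OF t ll C] N.left_lim_integral(2)[OF t ll C]]
    unfolding stieltjes_integral_def sum_subtractf[symmetric] by (simp del: sum.lessThan_Suc)
qed

text \<open>The bounds for the two parts add up, because the positive and the negative variation sum
  to \<open>TV\<close>.\<close>

lemma stieltjes_integral_increment:
  assumes st: "0 \<le> s" "s \<le> t" and ll: "has_left_lims t f" and C: "\<And>s. s \<in> {0..<t} \<Longrightarrow> \<bar>f s\<bar> \<le> C"
  shows "\<bar>stieltjes_integral G (left_lim f) t - stieltjes_integral G (left_lim f) s\<bar> \<le> C * (TV t - TV s)"
proof -
  have "C * (TV t - TV s) = C * (pos_variation G t - pos_variation G s) + C * (neg_variation G t - neg_variation G s)"
    using pos_neg_variation(1)[of s] pos_neg_variation(1)[of t] st by (simp add: algebra_simps flip: distrib_left)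
  then show ?thesis
    using P.left_lim_integral_increment[OF st ll C] N.left_lim_integral_increment[OF st ll C]
    unfolding stieltjes_integral_def by linarith
qed

end

section \<open>The equation along a single path\<close>

lemma mono_on_has_left_limit:
  fixes h :: "real \<Rightarrow> real"
  assumes "0 < t" and mono: "\<And>r s. 0 \<le> r \<Longrightarrow> r \<le> s \<Longrightarrow> s \<le> t \<Longrightarrow> h r \<le> h s"
  shows "\<exists>l. (h \<longlongrightarrow> l) (at_left t)"
proof
  let ?S = "SUP s\<in>{0..<t}. h s"
  have bdd: "bdd_above (h ` {0..<t})"
    using mono by (intro bdd_aboveI[of _ "h t"]) auto
  show "(h \<longlongrightarrow> ?S) (at_left t)"
  proof (rule order_tendstoI)
    fix c assume "?S < c"
    then have "h s < c" if "0 \<le> s" "s < t" for s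
      using cSUP_upper[OF _ bdd, of s] that by auto
    then show "\<forall>\<^sub>F s in at_left t. h s < c"
      by (intro eventually_at_left_ge0 assms)
  next
    fix c assume "c < ?S"
    then obtain r where r: "0 \<le> r" "r < t" "c < h r"
      using assms(1) by (subst (asm) less_cSUP_iff[OF _ bdd]) auto
    have "c < h s" if "r < s" "s < t" for s
      using mono[of r s] r that by auto
    then show "\<forall>\<^sub>F s in at_left t. c < h s"
      unfolding eventually_at_left_field using r(2) by blast
  qed
qed

text \<open>Right-continuity is inherited by comparison. For the left limits, \<open>m + f\<close>
  and \<open>m\<close> are both nondecreasing, so \<open>f\<close> is a difference of monotone
  functions.\<close>

lemma cadlag_before_dominated:
  assumes m_rc: "\<And>t. 0 \<le> t \<Longrightarrow> ennreal t < T \<Longrightarrow> (m \<longlongrightarrow> m t) (at_right t)"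
    and incr: "\<And>s t. 0 \<le> s \<Longrightarrow> s \<le> t \<Longrightarrow> ennreal t < T \<Longrightarrow> \<bar>f t - f s\<bar> \<le> m t - m s"
  shows "cadlag_before T f"
  unfolding cadlag_before_def
proof (intro allI impI conjI)
  fix t :: real assume t: "0 \<le> t" "ennreal t < T"
  obtain u where u: "t < u" "ennreal u < T"
    using t by (metis dense ennreal_less_iff enn2real_ennreal ennreal_cases less_le_trans top_greatest linorder_not_less order_less_irrefl)
  have "\<forall>\<^sub>F s in at_right t. \<bar>f s - f t\<bar> \<le> m s - m t"
    unfolding eventually_at_right_field
    using u t incr[of t] by (intro exI[of _ u]) (meson ennreal_leI le_less_trans less_imp_le)
  moreover have "((\<lambda>s. m s - m t) \<longlongrightarrow> 0) (at_right t)"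
    using tendsto_diff[OF m_rc[OF t] tendsto_const[of "m t"]] by simp
  ultimately have "((\<lambda>s. f s - f t) \<longlongrightarrow> 0) (at_right t)"
    by (intro Lim_null_comparison[of "\<lambda>s. f s - f t"]) auto
  then show "(f \<longlongrightarrow> f t) (at_right t)" by (simp add: LIM_zero_iff)
  assume "0 < t"
  have T: "ennreal s < T" if "s \<le> t" for s
    using that t by (meson ennreal_leI le_less_trans)
  have "\<exists>l. ((\<lambda>s. m s + f s) \<longlongrightarrow> l) (at_left t)"
    by (rule mono_on_has_left_limit[OF \<open>0 < t\<close>]) (smt (verit) incr T)
  moreover have "\<exists>l. (m \<longlongrightarrow> l) (at_left t)"
    by (rule mono_on_has_left_limit[OF \<open>0 < t\<close>]) (smt (verit) incr T)
  ultimately obtain k l where "((\<lambda>s. m s + f s) \<longlongrightarrow> k) (at_left t)" "(m \<longlongrightarrow> l) (at_left t)"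
    by blast
  then have "(f \<longlongrightarrow> k - l) (at_left t)" using tendsto_diff by fastforce
  then show "\<exists>l. (f \<longlongrightarrow> l) (at_left t)" ..
qed

lemma cadlag_before_has_left_lims: "cadlag_before T f \<Longrightarrow> ennreal t < T \<Longrightarrow> has_left_lims t f"
  unfolding cadlag_before_def has_left_lims_def
  by (meson ennreal_leI greaterThanAtMost_iff le_less_trans less_imp_le)

text \<open>Multiply by the conjugate: the sum of the roots is at least
  \<open>2 * sqrt (c / 2)\<close>, hence at least \<open>sqrt c\<close>. The lower edge of the band
  enters the contraction here.\<close>

lemma abs_sqrt_diff_le:
  assumes "0 < c" "c / 2 \<le> x" "c / 2 \<le> y"
  shows "\<bar>sqrt x - sqrt y\<bar> \<le> \<bar>x - y\<bar> / sqrt c"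
proof -
  have pos: "0 < x" "0 < y" using assms by auto
  have "sqrt c \<le> 2 * sqrt (c / 2)"
    using assms by (intro real_le_lsqrt) (simp_all add: power_mult_distrib)
  also have "2 * sqrt (c/2) \<le> sqrt x + sqrt y" using assms real_sqrt_le_mono[of "c/2" x] real_sqrt_le_mono[of "c/2" y] by linarith
  finally have *: "sqrt c \<le> sqrt x + sqrt y" .
  have "\<bar>sqrt x - sqrt y\<bar> * (sqrt x + sqrt y) = \<bar>(sqrt x - sqrt y) * (sqrt x + sqrt y)\<bar>"
    using pos by (simp add: abs_mult)
  also have "\<dots> = \<bar>x - y\<bar>" using pos by (simp add: algebra_simps)
  finally have "\<bar>sqrt x - sqrt y\<bar> * sqrt c \<le> \<bar>x - y\<bar>"
    using mult_left_mono[OF *, of "\<bar>sqrt x - sqrt y\<bar>"] by simp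
  then show ?thesis using assms(1) by (simp add: pos_le_divide_eq)
qed

lemma set_integral_lborel_singleton:
  fixes f :: "real \<Rightarrow> real"
  shows "set_integrable lborel {p} f" "(LINT s:{p}|lborel. f s) = 0"
proof -
  have eq: "(\<lambda>u. indicator {p} u *\<^sub>R f u) = (\<lambda>u. f p * indicator {p} u)"
    by (auto simp: indicator_def)
  show "set_integrable lborel {p} f"
    unfolding set_integrable_def eq by (intro integrable_mult_right integrable_real_indicator) auto
  show "(LINT s:{p}|lborel. f s) = 0"
    unfolding set_lebesgue_integral_def eq by simp
qed

text \<open>The drift integral of the equation includes time 0, where the left limit depends on
  values at negative times. A single point is Lebesgue-null, so the half-open interval seen by the
  Riemann sums gives the same integral.\<close>

lemma set_integral_lborel_Icc_Ioc:
  fixes f :: "real \<Rightarrow> real"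
  assumes "a \<le> b" "set_integrable lborel {a<..b} f"
  shows "(LINT s:{a..b}|lborel. f s) = (LINT s:{a<..b}|lborel. f s)"
proof -
  have "{a..b} = {a} \<union> {a<..b}" using assms(1) by auto
  then show ?thesis
    using set_integral_Un[OF _ set_integral_lborel_singleton(1) assms(2)]
    by (simp add: set_integral_lborel_singleton)
qed

text \<open>On \<open>[0, T)\<close> the time horizon, the subordinator and the variation of the integrator are so
  small that the integral operator maps paths with values in \<open>[x0/2, 2 x0]\<close> to paths with values in
  \<open>[3 x0/4, 5 x0/4]\<close> and contracts the supremum norm by \<open>1/2\<close>.\<close>

locale rate_path = bv_integrator G for G :: "real \<Rightarrow> real" +
  fixes \<kappa> a \<theta> \<sigma> \<rho> x0 c \<epsilon> :: real and v g :: "real \<Rightarrow> real" and T :: ennreal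
  assumes pos: "0 < \<kappa>" "0 < a" "0 \<le> \<theta>" "0 < \<sigma>" "0 < x0" "0 \<le> c"
    and v_cadlag: "cadlag_before T v"
    and v_bounds: "0 \<le> t \<Longrightarrow> ennreal t < T \<Longrightarrow> 0 \<le> v t \<and> v t \<le> c"
    and g_mono: "0 \<le> s \<Longrightarrow> s \<le> t \<Longrightarrow> g s \<le> g t"
    and g_right_cont: "0 \<le> t \<Longrightarrow> (g \<longlongrightarrow> g t) (at_right t)"
    and small: "0 \<le> t \<Longrightarrow> ennreal t < T \<Longrightarrow> t + (g t - g 0) + TV t \<le> \<epsilon>"
    and \<epsilon>_bound: "(\<kappa> * (a + 2 * x0) + \<sigma> * \<bar>\<rho>\<bar> * sqrt (c * (2 * x0)) + \<theta> + \<sigma> * sqrt (2 * x0)) * \<epsilon> \<le> x0 / 4"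
    and \<epsilon>_contr: "(\<kappa> + \<sigma> * \<bar>\<rho>\<bar> * sqrt c / sqrt x0 + \<sigma> / sqrt x0) * \<epsilon> \<le> 1 / 2"
begin

section \<open>The integral operator and its estimates\<close>

definition "clock t = t + (g t - g 0) + TV t"

definition "drift_bound = \<kappa> * (a + 2 * x0) + \<sigma> * \<bar>\<rho>\<bar> * sqrt (c * (2 * x0))"

text \<open>The Lipschitz constant of the right-hand side with respect to \<open>clock\<close>, with
  one summand each for drift, subordinator and Stieltjes integral; \<open>\<epsilon>_bound\<close>
  says \<open>K * \<epsilon> \<le> x0 / 4\<close>.\<close>

definition "K = drift_bound + \<theta> + \<sigma> * sqrt (2 * x0)"

text \<open>Formed from the values and not from the left limits: its left limit is the integrand of
  the equation, so its left-endpoint sums converge to the drift integral.\<close>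

definition drift :: "(real \<Rightarrow> real) \<Rightarrow> real \<Rightarrow> real"
  where "drift x s = \<kappa> * (a - x s) - \<sigma> * \<rho> * sqrt (v s * x s)"

definition rhs :: "(real \<Rightarrow> real) \<Rightarrow> real \<Rightarrow> real"
  where "rhs x t = x0 + (LINT s:{0..t}|lborel.
        \<kappa> * (a - left_lim x s) - \<sigma> * \<rho> * sqrt (left_lim v s * left_lim x s))
      + \<theta> * (g t - g 0)
      + \<sigma> * stieltjes_integral G (\<lambda>s. sqrt (left_lim x s)) t"

definition riemann_rhs :: "(real \<Rightarrow> real) \<Rightarrow> real \<Rightarrow> nat \<Rightarrow> real"
  where "riemann_rhs x t n = x0
      + (\<Sum>j<Suc n. drift x (grid t n j) * (grid t n (Suc j) - grid t n j))
      + \<theta> * (g t - g 0)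
      + \<sigma> * (\<Sum>j<Suc n. sqrt (x (grid t n j)) * (G (grid t n (Suc j)) - G (grid t n j)))"

text \<open>The band is imposed strictly before \<open>t\<close> only, because the right-hand side
  at \<open>t\<close> sees the path through its left limits. A bound at \<open>t\<close> can
  therefore be derived without knowing the value there.\<close>

definition admissible :: "real \<Rightarrow> (real \<Rightarrow> real) \<Rightarrow> bool"
  where "admissible t x \<longleftrightarrow> has_left_lims t x \<and> (\<forall>s\<in>{0..<t}. x0 / 2 \<le> x s \<and> x s \<le> 2 * x0)"

lemma clock_0 [simp]: "clock 0 = 0" by (simp add: clock_def)

lemma before_T: "s \<le> t \<Longrightarrow> ennreal t < T \<Longrightarrow> ennreal s < T"
  by (meson ennreal_leI le_less_trans)

lemma TV_mono: "0 \<le> s \<Longrightarrow> s \<le> t \<Longrightarrow> TV s \<le> TV t"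
  using TV_increment[of s t] by linarith

lemma clock_parts:
  assumes "0 \<le> s" "s \<le> t"
  shows "t - s \<le> clock t - clock s" "g t - g s \<le> clock t - clock s" "TV t - TV s \<le> clock t - clock s"
  using TV_mono[OF assms] g_mono[OF assms] assms by (auto simp: clock_def)

lemma clock_le: "0 \<le> t \<Longrightarrow> ennreal t < T \<Longrightarrow> clock t \<le> \<epsilon>"
  using small by (simp add: clock_def)

lemma clock_right_cont: "0 \<le> t \<Longrightarrow> (clock \<longlongrightarrow> clock t) (at_right t)"
  unfolding clock_def[abs_def] by (intro tendsto_intros g_right_cont TV_right_cont)

lemma K_nonneg: "0 \<le> drift_bound" "0 \<le> K"
  using pos by (auto simp: K_def drift_bound_def)

lemma admissible_subset: "admissible t x \<Longrightarrow> s \<le> t \<Longrightarrow> admissible s x"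
  by (auto simp: admissible_def intro: has_left_lims_subset)

lemma admissible_left_lim:
  assumes "admissible t x" "s \<in> {0<..t}"
  shows "x0 / 2 \<le> left_lim x s"
  using left_lim_mem[of t x s "{x0/2..2*x0}"] assms by (auto simp: admissible_def)

lemma v_left_lim: "s \<in> {0<..t} \<Longrightarrow> ennreal t < T \<Longrightarrow> 0 \<le> left_lim v s"
  using left_lim_mem[OF cadlag_before_has_left_lims[OF v_cadlag], of t s "{0..}"] v_bounds before_T[of _ t]
  by auto

lemma drift_limit:
  assumes "admissible t x" "ennreal t < T" "s \<in> {0<..t}"
  shows "(drift x \<longlongrightarrow> \<kappa> * (a - left_lim x s) - \<sigma> * \<rho> * sqrt (left_lim v s * left_lim x s)) (at_left s)"
  unfolding drift_def[abs_def]
  by (intro tendsto_intros tendsto_left_lim[of t])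
    (use assms cadlag_before_has_left_lims[OF v_cadlag] in \<open>auto simp: admissible_def\<close>)

lemma sqrt_limit:
  assumes "admissible t x" "s \<in> {0<..t}"
  shows "((\<lambda>s. sqrt (x s)) \<longlongrightarrow> sqrt (left_lim x s)) (at_left s)"
  by (intro tendsto_intros tendsto_left_lim[of t]) (use assms in \<open>auto simp: admissible_def\<close>)

lemma has_left_lims_integrands:
  assumes "admissible t x" "ennreal t < T"
  shows "has_left_lims t (drift x)" "has_left_lims t (\<lambda>s. sqrt (x s))"
  using drift_limit[OF assms] sqrt_limit[OF assms(1)] unfolding has_left_lims_def by blast+

lemma integrand_bounds:
  assumes "admissible t x" "ennreal t < T" "s \<in> {0..<t}"
  shows "\<bar>drift x s\<bar> \<le> drift_bound" "\<bar>sqrt (x s)\<bar> \<le> sqrt (2 * x0)"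
proof -
  have x: "x0 / 2 \<le> x s" "x s \<le> 2 * x0" using assms by (auto simp: admissible_def)
  have v: "0 \<le> v s" "v s \<le> c" using v_bounds[of s] before_T[of s t] assms by auto
  show "\<bar>sqrt (x s)\<bar> \<le> sqrt (2 * x0)" using x pos by simp
  have "\<bar>\<kappa> * (a - x s)\<bar> \<le> \<kappa> * (a + 2 * x0)"
    unfolding abs_mult using x pos by (intro mult_mono) auto
  moreover have "\<bar>\<sigma> * \<rho> * sqrt (v s * x s)\<bar> \<le> \<sigma> * \<bar>\<rho>\<bar> * sqrt (c * (2 * x0))"
    unfolding abs_mult using x v pos by (intro mult_mono) (auto intro!: mult_mono)
  ultimately show "\<bar>drift x s\<bar> \<le> drift_bound"
    unfolding drift_def drift_bound_def by linarith
qed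

text \<open>Left limits pass through the continuous coefficients, which brings both integrals into
  the form \<open>left_lim\<close> of one function, as the limit lemmas require.\<close>

lemma rhs_eq:
  assumes "admissible t x" "ennreal t < T" "0 \<le> s" "s \<le> t"
  shows "rhs x s = x0 + (LINT u:{0<..s}|interval_measure (\<lambda>x. x). left_lim (drift x) u)
      + \<theta> * (g s - g 0) + \<sigma> * stieltjes_integral G (left_lim (\<lambda>s. sqrt (x s))) s"
proof -
  let ?f = "\<lambda>u. \<kappa> * (a - left_lim x u) - \<sigma> * \<rho> * sqrt (left_lim v u * left_lim x u)"
  have eq: "left_lim (drift x) u = ?f u" if "u \<in> {0<..s}" for u
    using left_limI[OF drift_limit[OF assms(1,2)]] assms(4) that by auto
  have "set_integrable lborel {0<..s} (left_lim (drift x))"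
    unfolding lborel_eq_real
    by (rule stieltjes_measure.left_lim_integral(1)[OF stieltjes_measure_id assms(3), where C = drift_bound])
      (use has_left_lims_integrands[OF assms(1,2)] has_left_lims_subset integrand_bounds[OF assms(1,2)] assms(4) in auto)
  then have "set_integrable lborel {0<..s} ?f"
    by (rule iffD1[OF set_integrable_cong[OF refl refl eq], rotated])
  then have "(LINT u:{0..s}|lborel. ?f u) = (LINT u:{0<..s}|lborel. ?f u)"
    by (rule set_integral_lborel_Icc_Ioc[OF assms(3)])
  moreover have "\<dots> = (LINT u:{0<..s}|lborel. left_lim (drift x) u)"
    using eq by (intro set_lebesgue_integral_cong) auto
  moreover have "stieltjes_integral G (\<lambda>s. sqrt (left_lim x s)) s
      = stieltjes_integral G (left_lim (\<lambda>s. sqrt (x s))) s"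
    using left_limI[OF sqrt_limit[OF assms(1)]] assms(4) unfolding stieltjes_integral_def
    by (intro arg_cong2[where f="(-)"] set_lebesgue_integral_cong) auto
  ultimately show ?thesis unfolding rhs_def lborel_eq_real by simp
qed

lemma riemann_rhs_tendsto:
  assumes "admissible t x" "ennreal t < T" "0 \<le> t"
  shows "riemann_rhs x t \<longlonglongrightarrow> rhs x t"
  unfolding riemann_rhs_def[abs_def] rhs_eq[OF assms order_refl]
  by (intro tendsto_intros stieltjes_integral_sums[where C = "sqrt (2 * x0)"]
      stieltjes_measure.left_lim_integral(2)[OF stieltjes_measure_id, where C = drift_bound])
    (use assms has_left_lims_integrands integrand_bounds in auto)

lemma rhs_0 [simp]: "rhs x 0 = x0"
  using set_integral_lborel_singleton(2)[of 0]
  by (simp add: rhs_def stieltjes_integral_def set_lebesgue_integral_def)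

lemma rhs_increment:
  assumes "admissible t x" "ennreal t < T" "0 \<le> s" "s \<le> t"
  shows "\<bar>rhs x t - rhs x s\<bar> \<le> K * (clock t - clock s)"
proof -
  have t: "0 \<le> t" using assms by simp
  note ll = has_left_lims_integrands[OF assms(1,2)] and bd = integrand_bounds[OF assms(1,2)]
  let ?D = "\<lambda>s. (LINT u:{0<..s}|interval_measure (\<lambda>x. x). left_lim (drift x) u)"
  let ?S = "stieltjes_integral G (left_lim (\<lambda>s. sqrt (x s)))"
  have "\<bar>?D t - ?D s\<bar> \<le> drift_bound * (t - s)"
    by (rule stieltjes_measure.left_lim_integral_increment[OF stieltjes_measure_id assms(3,4) ll(1) bd(1)])
  also have "\<dots> \<le> drift_bound * (clock t - clock s)"
    by (intro mult_left_mono clock_parts K_nonneg assms)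
  finally have 1: "\<bar>?D t - ?D s\<bar> \<le> drift_bound * (clock t - clock s)" .
  have 2: "\<theta> * (g t - g s) \<le> \<theta> * (clock t - clock s)" "0 \<le> \<theta> * (g t - g s)"
    using pos g_mono[OF assms(3,4)] by (auto intro!: mult_left_mono clock_parts assms)
  have "\<bar>?S t - ?S s\<bar> \<le> sqrt (2 * x0) * (TV t - TV s)"
    by (rule stieltjes_integral_increment[OF assms(3,4) ll(2) bd(2)])
  also have "\<dots> \<le> sqrt (2 * x0) * (clock t - clock s)"
    using pos by (intro mult_left_mono clock_parts assms) auto
  finally have "\<bar>\<sigma> * (?S t - ?S s)\<bar> \<le> \<sigma> * (sqrt (2 * x0) * (clock t - clock s))"
    using pos by (simp add: abs_mult)
  with 1 2 show ?thesis
    unfolding rhs_eq[OF assms(1,2,3,4)] rhs_eq[OF assms(1,2) t order_refl] K_def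
    by (simp add: algebra_simps abs_le_iff)
qed

lemma rhs_range:
  assumes "admissible t x" "ennreal t < T" "0 \<le> t"
  shows "\<bar>rhs x t - x0\<bar> \<le> x0 / 4"
proof -
  have "\<bar>rhs x t - x0\<bar> \<le> K * clock t"
    using rhs_increment[OF assms(1,2) order_refl assms(3)] by simp
  also have "\<dots> \<le> K * \<epsilon>"
    by (intro mult_left_mono clock_le assms K_nonneg)
  also have "\<dots> \<le> x0 / 4" using \<epsilon>_bound by (simp add: K_def drift_bound_def)
  finally show ?thesis .
qed

text \<open>The estimate is made on the Riemann sums, where the two paths can be subtracted term by
  term and the variation enters through \<open>grid_variation_le\<close>; it then passes to the
  limit.\<close>

lemma rhs_contraction:
  assumes "admissible t x" "admissible t y" "ennreal t < T" "0 \<le> t"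
    and d: "\<And>s. s \<in> {0..<t} \<Longrightarrow> \<bar>x s - y s\<bar> \<le> d" and "0 \<le> d"
  shows "\<bar>rhs x t - rhs y t\<bar> \<le> d / 2"
proof (cases "t = 0")
  case True
  then show ?thesis using \<open>0 \<le> d\<close> by simp
next
  case False
  then have t: "0 < t" using assms(4) by simp
  define L where "L = \<kappa> + \<sigma> * \<bar>\<rho>\<bar> * sqrt c / sqrt x0"
  have L: "0 \<le> L" using pos by (simp add: L_def)
  have sq: "\<bar>sqrt (x s) - sqrt (y s)\<bar> \<le> d / sqrt x0" if s: "s \<in> {0..<t}" for s
  proof -
    have "\<bar>sqrt (x s) - sqrt (y s)\<bar> \<le> \<bar>x s - y s\<bar> / sqrt x0"
      using assms(1,2) s pos by (intro abs_sqrt_diff_le) (auto simp: admissible_def)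
    also have "\<dots> \<le> d / sqrt x0" using d[OF s] pos by (intro divide_right_mono) auto
    finally show ?thesis .
  qed
  have dr: "\<bar>drift x s - drift y s\<bar> \<le> L * d" if s: "s \<in> {0..<t}" for s
  proof -
    have v: "0 \<le> v s" "v s \<le> c" using v_bounds[of s] before_T[of s t] assms(3) s by auto
    \<comment> \<open>Factoring out \<open>sqrt (v s)\<close> leaves a difference of roots of values
      in the band only, so \<open>v s\<close> may be 0 and just its upper bound \<open>c\<close>
      matters.\<close>
    have "drift x s - drift y s = \<kappa> * (y s - x s) + \<sigma> * \<rho> * (sqrt (v s) * (sqrt (y s) - sqrt (x s)))"
      by (simp add: drift_def real_sqrt_mult algebra_simps)
    also have "\<bar>\<dots>\<bar> \<le> \<kappa> * d + \<sigma> * \<bar>\<rho>\<bar> * (sqrt c * (d / sqrt x0))"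
    proof (rule order_trans[OF abs_triangle_ineq add_mono])
      show "\<bar>\<kappa> * (y s - x s)\<bar> \<le> \<kappa> * d"
        using d[OF s] pos by (simp add: abs_mult abs_minus_commute)
      show "\<bar>\<sigma> * \<rho> * (sqrt (v s) * (sqrt (y s) - sqrt (x s)))\<bar> \<le> \<sigma> * \<bar>\<rho>\<bar> * (sqrt c * (d / sqrt x0))"
        unfolding abs_mult using pos v sq[OF s] by (intro mult_mono) (auto simp: abs_minus_commute)
    qed
    also have "\<dots> = L * d" by (simp add: L_def algebra_simps)
    finally show ?thesis .
  qed
  have "\<bar>riemann_rhs x t n - riemann_rhs y t n\<bar> \<le> d / 2" for n
  proof -
    have cell: "grid t n j \<in> {0..<t}" "grid t n j \<le> grid t n (Suc j)" if "j < Suc n" for j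
      using that grid_nonneg grid_less grid_mono[of t j "Suc j" n] t by auto
    have "\<bar>\<Sum>j<Suc n. (drift x (grid t n j) - drift y (grid t n j)) * (grid t n (Suc j) - grid t n j)\<bar>
        \<le> (\<Sum>j<Suc n. (L * d) * (grid t n (Suc j) - grid t n j))"
    proof (rule order_trans[OF sum_abs sum_mono])
      fix j assume "j \<in> {..<Suc n}"
      then show "\<bar>(drift x (grid t n j) - drift y (grid t n j)) * (grid t n (Suc j) - grid t n j)\<bar>
          \<le> (L * d) * (grid t n (Suc j) - grid t n j)"
        using cell[of j] dr by (simp add: abs_mult mult_right_mono)
    qed
    also have "\<dots> = L * d * t"
      unfolding sum_distrib_left[symmetric] using sum_grid_diff[of "\<lambda>x. x"] by simp
    finally have 1: "\<bar>\<Sum>j<Suc n. (drift x (grid t n j) - drift y (grid t n j)) * (grid t n (Suc j) - grid t n j)\<bar> \<le> L * d * t" .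
    have "\<bar>\<Sum>j<Suc n. (sqrt (x (grid t n j)) - sqrt (y (grid t n j))) * (G (grid t n (Suc j)) - G (grid t n j))\<bar>
        \<le> (\<Sum>j<Suc n. (d / sqrt x0) * \<bar>G (grid t n (Suc j)) - G (grid t n j)\<bar>)"
    proof (rule order_trans[OF sum_abs sum_mono])
      fix j assume "j \<in> {..<Suc n}"
      then show "\<bar>(sqrt (x (grid t n j)) - sqrt (y (grid t n j))) * (G (grid t n (Suc j)) - G (grid t n j))\<bar>
          \<le> (d / sqrt x0) * \<bar>G (grid t n (Suc j)) - G (grid t n j)\<bar>"
        using cell(1)[of j] sq unfolding abs_mult by (intro mult_right_mono) auto
    qed
    also have "\<dots> \<le> (d / sqrt x0) * TV t"
      unfolding sum_distrib_left[symmetric]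
      using \<open>0 \<le> d\<close> pos by (intro mult_left_mono grid_variation_le bv assms) auto
    finally have 2: "\<sigma> * \<bar>\<Sum>j<Suc n. (sqrt (x (grid t n j)) - sqrt (y (grid t n j))) * (G (grid t n (Suc j)) - G (grid t n j))\<bar>
        \<le> \<sigma> * (d / sqrt x0 * TV t)" using pos(4) by (intro mult_left_mono) auto
    have eq: "riemann_rhs x t n - riemann_rhs y t n =
        (\<Sum>j<Suc n. (drift x (grid t n j) - drift y (grid t n j)) * (grid t n (Suc j) - grid t n j))
        + \<sigma> * (\<Sum>j<Suc n. (sqrt (x (grid t n j)) - sqrt (y (grid t n j))) * (G (grid t n (Suc j)) - G (grid t n j)))"
      unfolding riemann_rhs_def left_diff_distrib sum_subtractf right_diff_distrib by simp
    have "\<bar>riemann_rhs x t n - riemann_rhs y t n\<bar> \<le> L * d * t + \<sigma> * (d / sqrt x0 * TV t)"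
      unfolding eq using 1 2 pos by (intro order_trans[OF abs_triangle_ineq add_mono]) (auto simp only: abs_mult abs_of_pos)
    \<comment> \<open>\<open>t\<close> and \<open>TV t\<close> are nonnegative summands of the small
      clock, hence each at most \<open>\<epsilon>\<close>. The subordinator term is common to both
      paths and has cancelled.\<close>
    also have "\<dots> \<le> L * d * \<epsilon> + \<sigma> * (d / sqrt x0 * \<epsilon>)"
      using small[OF assms(4,3)] TV_mono[of 0 t] g_mono[of 0 t] t \<open>0 \<le> d\<close> pos L
      by (intro add_mono mult_left_mono) auto
    also have "\<dots> = ((L + \<sigma> / sqrt x0) * \<epsilon>) * d" by (simp add: algebra_simps)
    also have "\<dots> \<le> 1 / 2 * d"
      using \<epsilon>_contr \<open>0 \<le> d\<close> unfolding L_def by (intro mult_right_mono)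
    finally show ?thesis by simp
  qed
  then show ?thesis
    by (intro tendsto_upperbound[OF tendsto_rabs[OF tendsto_diff[OF riemann_rhs_tendsto riemann_rhs_tendsto]]])
      (use assms in auto)
qed

section \<open>Picard iteration: existence and uniqueness along a path\<close>

primrec picard :: "nat \<Rightarrow> real \<Rightarrow> real" where
  "picard 0 = (\<lambda>_. x0)"
| "picard (Suc n) = rhs (picard n)"

text \<open>Strictness leaves room around the value, which the exit argument for competing solutions
  exploits.\<close>

lemma strict_band: "\<bar>z - x0\<bar> \<le> x0 / 4 \<Longrightarrow> x0 / 2 < z \<and> z < 2 * x0"
  using pos(5) by linarith

lemma admissibleI:
  assumes "\<And>s t. 0 \<le> s \<Longrightarrow> s \<le> t \<Longrightarrow> ennreal t < T \<Longrightarrow> \<bar>x t - x s\<bar> \<le> K * (clock t - clock s)"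
    and "\<And>t. 0 \<le> t \<Longrightarrow> ennreal t < T \<Longrightarrow> \<bar>x t - x0\<bar> \<le> x0 / 4"
    and "ennreal t < T"
  shows "admissible t x" "cadlag_before T x"
proof -
  show "cadlag_before T x"
  proof (rule cadlag_before_dominated[where m = "\<lambda>t. K * clock t"])
    show "((\<lambda>t. K * clock t) \<longlongrightarrow> K * clock t) (at_right t)" if "0 \<le> t" for t
      using that by (intro tendsto_intros clock_right_cont)
  qed (use assms(1) in \<open>simp add: right_diff_distrib\<close>)
  then have "has_left_lims t x" by (rule cadlag_before_has_left_lims[OF _ assms(3)])
  moreover have "x0 / 2 \<le> x s \<and> x s \<le> 2 * x0" if "s \<in> {0..<t}" for s
    using strict_band[OF assms(2)[of s]] before_T[of s t] assms(3) that by auto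
  ultimately show "admissible t x" unfolding admissible_def by blast
qed

text \<open>The two bounds must be proved together: the increments supply the left limits and the
  range supplies the band, and both are needed to estimate the next iterate.\<close>

lemma picard_bounds:
  "(\<forall>s t. 0 \<le> s \<longrightarrow> s \<le> t \<longrightarrow> ennreal t < T \<longrightarrow> \<bar>picard n t - picard n s\<bar> \<le> K * (clock t - clock s)) \<and>
   (\<forall>t. 0 \<le> t \<longrightarrow> ennreal t < T \<longrightarrow> \<bar>picard n t - x0\<bar> \<le> x0 / 4)"
proof (induction n)
  case 0
  have "0 \<le> clock t - clock s" if "0 \<le> s" "s \<le> t" for s t
    using clock_parts(1)[OF that] that by linarith
  then show ?case using pos K_nonneg by simp
next
  case (Suc n)
  then have "admissible t (picard n)" if "ennreal t < T" for t
    using that by (intro admissibleI(1)) blast+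
  then show ?case using rhs_increment rhs_range by simp
qed

lemma picard_admissible: "ennreal t < T \<Longrightarrow> admissible t (picard n)"
  using picard_bounds by (intro admissibleI(1)) blast+

text \<open>The contraction at \<open>t\<close> consumes the bound at all earlier times, hence the
  induction over arbitrary \<open>t\<close>.\<close>

lemma picard_step:
  "0 \<le> t \<Longrightarrow> ennreal t < T \<Longrightarrow> \<bar>picard (Suc n) t - picard n t\<bar> \<le> x0 / 2 ^ n"
proof (induction n arbitrary: t)
  case 0
  then have "\<bar>picard (Suc 0) t - x0\<bar> \<le> x0 / 4" using picard_bounds[of "Suc 0"] by blast
  moreover have "picard 0 t = x0" by simp
  ultimately show ?case unfolding power_0 div_by_1 using pos(5) by linarith
next
  case (Suc n)
  have IH: "\<bar>picard (Suc n) s - picard n s\<bar> \<le> x0 / 2 ^ n" if "s \<in> {0..<t}" for s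
    using that Suc.prems by (intro Suc.IH before_T[of s t]) auto
  have nn: "0 \<le> x0 / 2 ^ n" using pos(5) by simp
  have "\<bar>rhs (picard (Suc n)) t - rhs (picard n) t\<bar> \<le> (x0 / 2 ^ n) / 2"
    by (rule rhs_contraction[OF picard_admissible picard_admissible Suc.prems(2,1) IH nn]) (rule Suc.prems(2))+
  moreover have "(x0 / 2 ^ n) / 2 = x0 / 2 ^ Suc n" by simp
  ultimately show ?case unfolding picard.simps(2) by (simp only:)
qed

definition solution :: "real \<Rightarrow> real"
  where "solution t = lim (\<lambda>n. picard n t)"

lemma picard_tendsto:
  assumes "0 \<le> t" "ennreal t < T"
  shows "(\<lambda>n. picard n t) \<longlonglongrightarrow> solution t" "\<bar>solution t - picard n t\<bar> \<le> 2 * x0 / 2 ^ n"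
proof -
  \<comment> \<open>The subtracted term makes the induction close: the bound on one step is exactly
    the difference of two consecutive terms of this form.\<close>
  have *: "\<bar>picard (n + k) t - picard n t\<bar> \<le> 2 * x0 / 2 ^ n - 2 * x0 / 2 ^ (n + k)" for n k
  proof (induction k)
    case (Suc k)
    have "x0 / 2 ^ (n + k) = 2 * x0 / 2 ^ (n + k) - 2 * x0 / 2 ^ (n + Suc k)"
      by (simp add: field_simps)
    then show ?case using Suc picard_step[OF assms, of "n + k"] by simp
  qed simp
  have bound: "\<bar>picard (n + k) t - picard n t\<bar> \<le> 2 * x0 / 2 ^ n" for n k
    using *[of n k] pos by (smt (verit) divide_nonneg_nonneg zero_le_power)
  have "Cauchy (\<lambda>n. picard n t)"
  proof (rule CauchyI')
    fix e :: real assume "0 < e"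
    moreover have "(\<lambda>n. 2 * x0 * (1 / 2) ^ n) \<longlonglongrightarrow> 0"
      using tendsto_mult_right_zero[OF LIMSEQ_realpow_zero[of "1/2 :: real"]] by simp
    ultimately obtain N where N: "2 * x0 * (1 / 2) ^ n < e" if "n \<ge> N" for n
      by (metis (lifting) order_tendstoD(2) eventually_sequentially)
    show "\<exists>M. \<forall>m\<ge>M. \<forall>n>m. dist (picard m t) (picard n t) < e"
    proof (intro exI[of _ N] allI impI)
      fix m n assume "N \<le> m" "m < n"
      then show "dist (picard m t) (picard n t) < e"
        using bound[of m "n - m"] N[of m] by (simp add: dist_real_def abs_minus_commute power_one_over)
    qed
  qed
  then show lim: "(\<lambda>n. picard n t) \<longlonglongrightarrow> solution t"
    unfolding solution_def by (simp add: Cauchy_convergent_iff convergent_LIMSEQ_iff)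
  have "(\<lambda>k. \<bar>picard (k + n) t - picard n t\<bar>) \<longlonglongrightarrow> \<bar>solution t - picard n t\<bar>"
    by (intro tendsto_intros LIMSEQ_ignore_initial_segment lim)
  then show "\<bar>solution t - picard n t\<bar> \<le> 2 * x0 / 2 ^ n"
    by (rule tendsto_upperbound) (use bound[of n] in \<open>auto simp: add.commute\<close>)
qed

lemma solution_bounds:
  "0 \<le> s \<Longrightarrow> s \<le> t \<Longrightarrow> ennreal t < T \<Longrightarrow> \<bar>solution t - solution s\<bar> \<le> K * (clock t - clock s)"
  "0 \<le> t \<Longrightarrow> ennreal t < T \<Longrightarrow> \<bar>solution t - x0\<bar> \<le> x0 / 4"
proof -
  assume *: "0 \<le> s" "s \<le> t" "ennreal t < T"
  show "\<bar>solution t - solution s\<bar> \<le> K * (clock t - clock s)"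
    by (rule tendsto_upperbound[OF tendsto_rabs[OF tendsto_diff[OF picard_tendsto(1) picard_tendsto(1)]]])
      (use * picard_bounds before_T[of s t] in auto)
next
  assume *: "0 \<le> t" "ennreal t < T"
  show "\<bar>solution t - x0\<bar> \<le> x0 / 4"
    by (rule tendsto_upperbound[OF tendsto_rabs[OF tendsto_diff[OF picard_tendsto(1) tendsto_const]]])
      (use * picard_bounds in auto)
qed

lemma solution_admissible: "ennreal t < T \<Longrightarrow> admissible t solution"
  and solution_cadlag: "cadlag_before T solution"
proof -
  show 1: "ennreal t < T \<Longrightarrow> admissible t solution" for t
    using solution_bounds by (intro admissibleI(1)) blast+
  show "cadlag_before T solution"
  proof (cases "0 < T")
    case True
    then show ?thesis using solution_bounds by (intro admissibleI(2)[of _ 0]) auto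
  qed (simp add: cadlag_before_def)
qed

text \<open>The distance from \<open>solution\<close> to the iterates is bounded uniformly over
  earlier times, so the contraction carries the convergence through \<open>rhs\<close>.\<close>

lemma solution_fixed_point:
  assumes "0 \<le> t" "ennreal t < T"
  shows "rhs solution t = solution t"
proof -
  have "\<bar>rhs solution t - picard (Suc n) t\<bar> \<le> 2 * x0 / 2 ^ n / 2" for n
  proof -
    have bd: "\<bar>solution s - picard n s\<bar> \<le> 2 * x0 / 2 ^ n" if "s \<in> {0..<t}" for s
      using that assms by (intro picard_tendsto(2) before_T[of s t]) auto
    have nn: "0 \<le> 2 * x0 / 2 ^ n" using pos(5) by simp
    show ?thesis
      unfolding picard.simps(2)
      by (rule rhs_contraction[OF solution_admissible picard_admissible assms(2,1) bd nn]) (rule assms(2))+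
  qed
  then have "\<bar>rhs solution t - picard (Suc n) t\<bar> \<le> x0 * (1 / 2) ^ n" for n
    by (simp add: power_one_over)
  moreover have "(\<lambda>n. x0 * (1 / 2) ^ n) \<longlonglongrightarrow> 0"
    using tendsto_mult_right_zero[OF LIMSEQ_realpow_zero[of "1/2 :: real"]] by simp
  ultimately have "(\<lambda>n. rhs solution t - picard (Suc n) t) \<longlonglongrightarrow> 0"
    by (intro Lim_null_comparison[of "\<lambda>n. rhs solution t - picard (Suc n) t"]) auto
  moreover have "(\<lambda>n. rhs solution t - picard (Suc n) t) \<longlonglongrightarrow> rhs solution t - solution t"
    by (intro tendsto_intros LIMSEQ_Suc picard_tendsto assms)
  ultimately have "rhs solution t - solution t = 0" by (rule LIMSEQ_unique[symmetric])
  then show ?thesis by simp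
qed

lemma solution_satisfies_equation:
  assumes "0 \<le> t" "ennreal t < T"
  shows "foreign_rate_equation \<kappa> a \<theta> \<sigma> \<rho> x0 v g G solution t"
  unfolding foreign_rate_equation_def
proof (intro conjI ballI)
  fix s assume s: "s \<in> {0<..t}"
  then have "0 \<le> left_lim solution s"
    using admissible_left_lim[OF solution_admissible[OF assms(2)] s] pos by simp
  then show "0 \<le> left_lim solution s" "0 \<le> left_lim v s * left_lim solution s"
    using v_left_lim[OF s assms(2)] by auto
qed (use solution_fixed_point[OF assms] in \<open>simp add: rhs_def\<close>)

text \<open>A competing solution starts at \<open>x0\<close>; while it stays in \<open>[x0/2, 2 x0]\<close> it is even in
  \<open>[3 x0/4, 5 x0/4]\<close>, so right-continuity prevents it from leaving.\<close>

lemma solution_unique: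
  assumes cad: "cadlag_before T' y" and eq: "\<And>t. 0 \<le> t \<Longrightarrow> ennreal t < T' \<Longrightarrow>
      foreign_rate_equation \<kappa> a \<theta> \<sigma> \<rho> x0 v g G y t"
    and t: "0 \<le> t" "ennreal t < T" "ennreal t < T'"
  shows "y t = solution t"
proof -
  have fix_y: "y s = rhs y s" if "0 \<le> s" "s \<le> t" for s
    using eq[of s] that t by (auto simp: foreign_rate_equation_def rhs_def intro: le_less_trans ennreal_leI)
  have ll: "has_left_lims t y" by (rule cadlag_before_has_left_lims[OF cad t(3)])
  let ?out = "\<lambda>s. \<not> (x0 / 2 \<le> y s \<and> y s \<le> 2 * x0)"
  have "admissible t y"
  proof (rule ccontr)
    assume "\<not> admissible t y"
    then have ne: "{s. 0 \<le> s \<and> s < t \<and> ?out s} \<noteq> {}" using ll by (auto simp: admissible_def)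
    \<comment> \<open>The first exit time from the band.\<close>
    define S where "S = Inf {s. 0 \<le> s \<and> s < t \<and> ?out s}"
    have bdd: "bdd_below {s. 0 \<le> s \<and> s < t \<and> ?out s}" by (rule bdd_belowI[of _ 0]) auto
    have S: "0 \<le> S" unfolding S_def by (rule cInf_greatest[OF ne]) auto
    obtain s0 where s0: "0 \<le> s0" "s0 < t" "?out s0" using ne by blast
    have "S \<le> s0" unfolding S_def using s0 by (intro cInf_lower bdd) auto
    then have St: "S < t" using s0 by simp
    have in_before: "\<not> ?out s" if "0 \<le> s" "s < S" for s
      using cInf_lower[OF _ bdd, of s] that St unfolding S_def[symmetric] by fastforce
    then have "admissible S y"
      using has_left_lims_subset[OF ll, of S] St by (auto simp: admissible_def)
    \<comment> \<open>\<open>admissible S y\<close> does not speak about \<open>y S\<close>, but the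
      equation determines \<open>y S\<close> from the past. So even a jump at time \<open>S\<close>
      lands in the inner band.\<close>
    then have "\<bar>y S - x0\<bar> \<le> x0 / 4"
      using rhs_range[of S y] fix_y[of S] before_T[of S t] S St t by simp
    then have yS: "y S \<in> {x0 / 2<..<2 * x0}" using strict_band by simp
    have "(y \<longlongrightarrow> y S) (at_right S)"
      using cad S before_T[of S t] St t unfolding cadlag_before_def by (meson ennreal_leI le_less_trans less_imp_le)
    then have "\<forall>\<^sub>F s in at_right S. y s \<in> {x0 / 2<..<2 * x0}"
      using yS by (intro topological_tendstoD) auto
    then obtain b where b: "S < b" "\<And>s. S < s \<Longrightarrow> s < b \<Longrightarrow> y s \<in> {x0 / 2<..<2 * x0}"
      unfolding eventually_at_right_field by blast
    have "b \<le> S"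
      unfolding S_def
    proof (rule cInf_greatest[OF ne])
      fix s assume s: "s \<in> {s. 0 \<le> s \<and> s < t \<and> ?out s}"
      show "b \<le> s"
        using s in_before[of s] yS b(2)[of s] by (cases s S rule: linorder_cases) force+
    qed
    with b(1) show False by simp
  qed
  then have adm: "admissible s y" if "s \<le> t" for s using that by (rule admissible_subset)
  \<comment> \<open>Both paths are fixed points of \<open>rhs\<close>, so each application of the
    contraction halves the bound at all times up to \<open>t\<close>.\<close>
  have "\<bar>y s - solution s\<bar> \<le> x0 / 2 ^ n" if "0 \<le> s" "s \<le> t" for n s
    using that
  proof (induction n arbitrary: s)
    case 0
    then have "\<bar>y s - x0\<bar> \<le> x0 / 4"
      using rhs_range[OF adm[of s]] fix_y[of s] before_T[of s t] t by simp
    moreover have "\<bar>solution s - x0\<bar> \<le> x0 / 4"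
      using 0 before_T[of s t] t by (intro solution_bounds) auto
    ultimately have "\<bar>y s - solution s\<bar> \<le> x0" using pos(5) by linarith
    then show ?case by simp
  next
    case (Suc n)
    have sT: "ennreal s < T" using before_T[of s t] Suc t by simp
    have "\<bar>rhs y s - rhs solution s\<bar> \<le> (x0 / 2 ^ n) / 2"
      by (rule rhs_contraction[OF adm solution_admissible]) (use Suc sT pos in auto)
    then show ?case using fix_y[of s] solution_fixed_point[of s] Suc sT by (simp add: mult.commute)
  qed
  then have *: "\<bar>y t - solution t\<bar> \<le> x0 * (1 / 2) ^ n" for n
    using t by (simp add: power_one_over)
  have "\<bar>y t - solution t\<bar> \<le> 0"
  proof (rule tendsto_lowerbound[of _ _ sequentially])
    show "(\<lambda>n. x0 * (1 / 2) ^ n) \<longlonglongrightarrow> 0"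
      using tendsto_mult_right_zero[OF LIMSEQ_realpow_zero[of "1/2 :: real"]] by simp
  qed (use * in auto)
  then show ?thesis by simp
qed

end

section \<open>Measurability and stopping times\<close>

text \<open>Where all subsets of \<open>N\<close> are measurable, arbitrary values on
  \<open>N\<close> do no harm. This lets path properties that hold only off a null set be used in
  measurability proofs.\<close>

lemma borel_measurable_restrict_null:
  fixes f :: "'a \<Rightarrow> 'b::topological_space"
  assumes null: "\<And>Z. Z \<subseteq> N \<Longrightarrow> Z \<in> sets A"
    and f: "f \<in> borel_measurable (restrict_space A (S - N))"
  shows "f \<in> borel_measurable (restrict_space A S)"
proof (rule measurableI)
  fix Y :: "'b set" assume Y: "Y \<in> sets borel"
  have "f -` Y \<inter> space (restrict_space A (S - N)) \<in> sets (restrict_space A (S - N))"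
    using f Y by (rule measurable_sets)
  then obtain Z where Z: "Z \<in> sets A" "f -` Y \<inter> ((S - N) \<inter> space A) = (S - N) \<inter> Z"
    by (auto simp: sets_restrict_space space_restrict_space)
  let ?Z = "(Z - N) \<union> (N \<inter> f -` Y \<inter> space A)"
  have "?Z \<in> sets A" using Z(1) null by auto
  moreover have "Z \<subseteq> space A" using Z(1) sets.sets_into_space by auto
  then have "f -` Y \<inter> (S \<inter> space A) = S \<inter> ?Z" using Z(2) by auto
  ultimately show "f -` Y \<inter> space (restrict_space A S) \<in> sets (restrict_space A S)"
    by (auto simp: sets_restrict_space space_restrict_space)
qed simp

text \<open>Needed because \<open>V s\<close> is measurable only on the event that s lies before its
  own lifetime, and for a smaller filtration, whereas the iterates live on a smaller event at a
  later time.\<close>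

lemma borel_measurable_restrict_mono:
  fixes f :: "'a \<Rightarrow> 'b::topological_space"
  assumes f: "f \<in> borel_measurable (restrict_space A S)"
    and AB: "space A = space B" "sets A \<subseteq> sets B" and "S' \<subseteq> S"
  shows "f \<in> borel_measurable (restrict_space B S')"
proof (rule measurableI)
  fix Y :: "'b set" assume Y: "Y \<in> sets borel"
  have "f -` Y \<inter> space (restrict_space A S) \<in> sets (restrict_space A S)"
    using f Y by (rule measurable_sets)
  then obtain Z where Z: "Z \<in> sets A" "f -` Y \<inter> (S \<inter> space A) = S \<inter> Z"
    by (auto simp: sets_restrict_space space_restrict_space)
  then have "f -` Y \<inter> (S' \<inter> space B) = S' \<inter> Z" using AB(1) \<open>S' \<subseteq> S\<close> by auto
  then show "f -` Y \<inter> space (restrict_space B S') \<in> sets (restrict_space B S')"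
    using Z(1) AB(2) by (auto simp: sets_restrict_space space_restrict_space)
qed simp

section \<open>The usual augmentation and rational hitting times\<close>

definition augmented_past :: "'a measure \<Rightarrow> (real \<Rightarrow> 'a \<Rightarrow> real) set \<Rightarrow> real \<Rightarrow> 'a set set"
  where "augmented_past M D u =
    sigma_sets (space M) ((\<Union>X\<in>D. process_sets M {0..u} X) \<union> null_sets M)"

lemma augmented_past_subset:
  "(\<Union>X\<in>D. process_sets M {0..u} X) \<union> null_sets M \<subseteq> Pow (space M)"
  using sets.sets_into_space[of _ M] by (auto simp: process_sets_def null_sets_def)

lemma augmented_past_mono: "D \<subseteq> D' \<Longrightarrow> augmented_past M D u \<subseteq> augmented_past M D' u"
  unfolding augmented_past_def by (intro sigma_sets_mono') auto

text \<open>The generating family is already a \<sigma>-algebra, being an intersection of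
  \<sigma>-algebras.\<close>

lemma sets_usual_augmentation:
  "sets (usual_augmentation M D t) = {A \<in> sets M. \<forall>u. t < ennreal u \<longrightarrow> A \<in> augmented_past M D u}"
    (is "_ = ?C")
proof -
  have sa: "sigma_algebra (space M) (augmented_past M D u)" for u
    unfolding augmented_past_def by (intro sigma_algebra_sigma_sets augmented_past_subset)
  have "sigma_algebra (space M) ?C"
    unfolding sigma_algebra_iff2
  proof (intro conjI ballI allI impI)
    show "?C \<subseteq> Pow (space M)" using sets.sets_into_space by auto
    show "{} \<in> ?C" using sa unfolding sigma_algebra_iff2 by auto
  next
    fix s assume "s \<in> ?C"
    then show "space M - s \<in> ?C" using sa unfolding sigma_algebra_iff2 by auto
  next
    fix A :: "nat \<Rightarrow> 'a set" assume "range A \<subseteq> ?C"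
    then have "range A \<subseteq> sets M" "\<And>u. t < ennreal u \<Longrightarrow> range A \<subseteq> augmented_past M D u" by auto
    then show "(\<Union>i. A i) \<in> ?C"
      using sa unfolding sigma_algebra_iff2 by (auto intro!: sets.countable_UN)
  qed
  then show ?thesis
    unfolding usual_augmentation_def augmented_past_def[symmetric]
    by (simp add: sigma_algebra.sets_measure_of_eq)
qed

lemma space_usual_augmentation [simp]: "space (usual_augmentation M D t) = space M"
  unfolding usual_augmentation_def
  by (rule space_measure_of) (use sets.sets_into_space in auto)

lemma usual_augmentation_mono:
  "D \<subseteq> D' \<Longrightarrow> t \<le> t' \<Longrightarrow> sets (usual_augmentation M D t) \<subseteq> sets (usual_augmentation M D' t')"
  unfolding sets_usual_augmentation
  using augmented_past_mono[of D D' M] le_less_trans[of t t'] by blast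

lemma sets_usual_augmentation_subset: "sets (usual_augmentation M D t) \<subseteq> sets M"
  unfolding sets_usual_augmentation by auto

lemma null_sets_usual_augmentation: "N \<in> null_sets M \<Longrightarrow> N \<in> sets (usual_augmentation M D t)"
  unfolding sets_usual_augmentation augmented_past_def by auto

text \<open>A rational time fits between \<open>t\<close> and any later \<open>u\<close>. At t =
  \<infinity> the second premise is vacuous and the first one decides.\<close>

lemma usual_augmentation_right_cont:
  assumes "A \<in> sets M" and "\<And>u. t < ennreal u \<Longrightarrow> A \<in> sets (usual_augmentation M D (ennreal u))"
  shows "A \<in> sets (usual_augmentation M D t)"
  unfolding sets_usual_augmentation
proof (intro CollectI conjI allI impI assms(1))
  fix u assume "t < ennreal u"
  then obtain q :: rat where "t < ennreal (real_of_rat q)" "ennreal (real_of_rat q) < ennreal u"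
    using ennreal_rat_dense by blast
  then show "A \<in> augmented_past M D u"
    using assms(2) unfolding sets_usual_augmentation by blast
qed

lemma borel_measurable_usual_augmentation:
  assumes "X \<in> D" "0 \<le> s" "s \<le> t" "X s \<in> borel_measurable M"
  shows "X s \<in> borel_measurable (usual_augmentation M D (ennreal t))"
proof (rule measurableI)
  fix Y :: "real set" assume Y: "Y \<in> sets borel"
  have "X s -` Y \<inter> space M \<in> augmented_past M D u" if "ennreal t < ennreal u" for u
  proof -
    have "t < u" using that assms by (simp add: ennreal_less_iff)
    then have "X s -` Y \<inter> space M \<in> process_sets M {0..u} X"
      unfolding process_sets_def using assms Y by fastforce
    then show ?thesis unfolding augmented_past_def using assms(1) by auto
  qed
  then show "X s -` Y \<inter> space (usual_augmentation M D (ennreal t)) \<in> sets (usual_augmentation M D (ennreal t))"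
    using measurable_sets[OF assms(4) Y] by (simp add: sets_usual_augmentation)
qed simp

text \<open>Rational times keep the resulting events countable unions; if none of them hits, the
  infimum of the empty set is \<infinity>.\<close>

definition first_rational_time :: "(real \<Rightarrow> 'a set) \<Rightarrow> 'a \<Rightarrow> ennreal"
  where "first_rational_time B \<omega> = (INF q\<in>{q\<in>\<rat>. 0 \<le> q \<and> \<omega> \<in> B q}. ennreal q)"

lemma first_rational_time_less_iff:
  "first_rational_time B \<omega> < t \<longleftrightarrow> (\<exists>q\<in>\<rat>. 0 \<le> q \<and> \<omega> \<in> B q \<and> ennreal q < t)"
  unfolding first_rational_time_def INF_less_iff by auto

lemma first_rational_time_le:
  "q \<in> \<rat> \<Longrightarrow> 0 \<le> q \<Longrightarrow> \<omega> \<in> B q \<Longrightarrow> first_rational_time B \<omega> \<le> ennreal q"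
  unfolding first_rational_time_def by (rule INF_lower) auto

text \<open>Hitting strictly before \<open>t\<close> is a countable union of past events. Including
  \<open>t\<close> itself requires a glance beyond \<open>t\<close>, which right-continuity of the
  augmentation absorbs.\<close>

lemma stopping_time_first_rational_time:
  assumes B: "\<And>q. 0 \<le> q \<Longrightarrow> B q \<in> sets (usual_augmentation M D (ennreal q))"
  shows "stopping_time (usual_augmentation M D) (first_rational_time B)"
proof
  let ?F = "usual_augmentation M D" and ?\<tau> = "first_rational_time B"
  fix t
  have less: "{\<omega>\<in>space M. ?\<tau> \<omega> < t} \<in> sets (?F t)" for t
  proof -
    have "B q \<in> sets (?F t)" if "0 \<le> q" "ennreal q < t" for q
      using B[OF that(1)] usual_augmentation_mono[OF order_refl less_imp_le[OF that(2)]] by blast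
    then have "(\<Union>q\<in>{q\<in>\<rat>. 0 \<le> q \<and> ennreal q < t}. B q) \<in> sets (?F t)"
      by (intro sets.countable_UN' countable_subset[OF _ countable_rat]) auto
    moreover have "B q \<subseteq> space M" if "0 \<le> q" for q
      using B[OF that] sets.sets_into_space by fastforce
    then have "{\<omega>\<in>space M. ?\<tau> \<omega> < t} = (\<Union>q\<in>{q\<in>\<rat>. 0 \<le> q \<and> ennreal q < t}. B q)"
      unfolding first_rational_time_less_iff by blast
    ultimately show ?thesis by simp
  qed
  have "{\<omega>\<in>space M. ?\<tau> \<omega> \<le> t} \<in> sets (?F t)"
  proof (cases "t = \<infinity>")
    case True
    then show ?thesis using sets.top[of "?F t"] by simp
  next
    case False
    have le: "{\<omega>\<in>space M. ?\<tau> \<omega> \<le> t} \<in> sets (?F (ennreal u))" if u: "t < ennreal u" for u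
    proof -
      \<comment> \<open>Only rationals up to \<open>u\<close> enter, so the intersection stays in
        the \<sigma>-algebra at time \<open>u\<close>.\<close>
      let ?Q = "{q::rat. t < ennreal (real_of_rat q) \<and> ennreal (real_of_rat q) \<le> ennreal u}"
      have "{\<omega>\<in>space M. ?\<tau> \<omega> < ennreal (real_of_rat q)} \<in> sets (?F (ennreal u))" if "q \<in> ?Q" for q
        using less[of "ennreal (real_of_rat q)"] that
          usual_augmentation_mono[OF order_refl, of "ennreal (real_of_rat q)" "ennreal u"] by blast
      moreover have "?Q \<noteq> {}"
        using ennreal_rat_dense[OF u] by (auto intro: less_imp_le)
      ultimately have "(\<Inter>q\<in>?Q. {\<omega>\<in>space M. ?\<tau> \<omega> < ennreal (real_of_rat q)}) \<in> sets (?F (ennreal u))"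
        by (intro sets.countable_INT') (auto intro: countableI_type)
      moreover have "?\<tau> \<omega> \<le> t \<longleftrightarrow> (\<forall>q\<in>?Q. ?\<tau> \<omega> < ennreal (real_of_rat q))" for \<omega>
      proof
        assume *: "\<forall>q\<in>?Q. ?\<tau> \<omega> < ennreal (real_of_rat q)"
        show "?\<tau> \<omega> \<le> t"
        proof (rule ccontr)
          assume "\<not> ?\<tau> \<omega> \<le> t"
          then have "t < min (?\<tau> \<omega>) (ennreal u)" using u by simp
          then obtain q :: rat where "t < ennreal (real_of_rat q)" "ennreal (real_of_rat q) < min (?\<tau> \<omega>) (ennreal u)"
            using ennreal_rat_dense by blast
          then show False using * by force
        qed
      qed auto
      then have "{\<omega>\<in>space M. ?\<tau> \<omega> \<le> t} = (\<Inter>q\<in>?Q. {\<omega>\<in>space M. ?\<tau> \<omega> < ennreal (real_of_rat q)})"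
        using \<open>?Q \<noteq> {}\<close> by auto
      ultimately show ?thesis by simp
    qed
    obtain u where "t < ennreal u"
      using False by (metis ennreal_rat_dense top.not_eq_extremum infinity_ennreal_def)
    then have "{\<omega>\<in>space M. ?\<tau> \<omega> \<le> t} \<in> sets M"
      using le sets_usual_augmentation_subset by blast
    then show ?thesis using le by (rule usual_augmentation_right_cont)
  qed
  then show "Measurable.pred (?F t) (\<lambda>\<omega>. ?\<tau> \<omega> \<le> t)"
    by (simp add: pred_def)
qed

text \<open>The random time is rounded up to multiples of 1 / (n + 1). With countably many values,
  measurability of \<open>W\<close> at fixed times suffices, and continuity of the paths gives the
  limit.\<close>

lemma borel_measurable_time_changed:
  fixes W :: "real \<Rightarrow> 'a \<Rightarrow> real^'n"
  assumes null: "\<And>Z. Z \<subseteq> N \<Longrightarrow> Z \<in> sets M"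
    and W: "\<And>s. 0 \<le> s \<Longrightarrow> W s \<in> borel_measurable M"
    and cont: "\<And>\<omega>. \<omega> \<in> space M - N \<Longrightarrow> continuous_on {0..} (\<lambda>s. W s \<omega>)"
    and \<gamma>: "\<gamma> t \<in> borel_measurable M" "\<And>\<omega>. \<omega> \<in> space M - N \<Longrightarrow> 0 \<le> \<gamma> t \<omega>"
  shows "time_changed W \<gamma> j t \<in> borel_measurable M"
proof -
  define k where "k n \<omega> = nat \<lceil>\<gamma> t \<omega> * real (Suc n)\<rceil>" for n \<omega>
  have k: "k n \<in> measurable M (count_space UNIV)" for n
    unfolding k_def using \<gamma>(1) by measurable
  have "(\<lambda>\<omega>. W (real (k n \<omega>) / real (Suc n)) \<omega>) \<in> borel_measurable M" for n
    by (rule measurable_compose_countable[OF W k]) simp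
  then have Wk: "(\<lambda>\<omega>. W (real (k n \<omega>) / real (Suc n)) \<omega> $ j) \<in> borel_measurable M" for n
    by (rule measurable_compose[OF _ borel_measurable_continuous_onI]) (intro continuous_intros)
  have "time_changed W \<gamma> j t \<in> borel_measurable (restrict_space M (space M - N))"
  proof (rule borel_measurable_LIMSEQ_real)
    fix \<omega> assume "\<omega> \<in> space (restrict_space M (space M - N))"
    then have \<omega>: "\<omega> \<in> space M - N" by (auto simp: space_restrict_space)
    have ge: "\<gamma> t \<omega> \<le> real (k n \<omega>) / real (Suc n)" "real (k n \<omega>) / real (Suc n) \<le> \<gamma> t \<omega> + inverse (real (Suc n))" for n
    proof -
      have "0 \<le> \<gamma> t \<omega> * real (Suc n)" using \<gamma>(2)[OF \<omega>] by simp
      then have "real (k n \<omega>) = of_int \<lceil>\<gamma> t \<omega> * real (Suc n)\<rceil>"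
        unfolding k_def by (metis ceiling_mono ceiling_zero of_nat_nat)
      then have "\<gamma> t \<omega> * real (Suc n) \<le> real (k n \<omega>)" "real (k n \<omega>) \<le> \<gamma> t \<omega> * real (Suc n) + 1"
        by linarith+
      then show "\<gamma> t \<omega> \<le> real (k n \<omega>) / real (Suc n)" "real (k n \<omega>) / real (Suc n) \<le> \<gamma> t \<omega> + inverse (real (Suc n))"
        by (simp_all add: pos_le_divide_eq pos_divide_le_eq distrib_right del: of_nat_Suc)
    qed
    have "(\<lambda>n. real (k n \<omega>) / real (Suc n)) \<longlonglongrightarrow> \<gamma> t \<omega>"
    proof (rule tendsto_sandwich[OF _ _ tendsto_const])
      show "(\<lambda>n. \<gamma> t \<omega> + inverse (real (Suc n))) \<longlonglongrightarrow> \<gamma> t \<omega>"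
        using tendsto_add[OF tendsto_const[of "\<gamma> t \<omega>"] LIMSEQ_inverse_real_of_nat] by simp
    qed (use ge in auto)
    then have "(\<lambda>n. W (real (k n \<omega>) / real (Suc n)) \<omega>) \<longlonglongrightarrow> W (\<gamma> t \<omega>) \<omega>"
      by (intro continuous_on_tendsto_compose[OF cont[OF \<omega>]]) (use \<gamma>(2)[OF \<omega>] in auto)
    then show "(\<lambda>n. W (real (k n \<omega>) / real (Suc n)) \<omega> $ j) \<longlonglongrightarrow> time_changed W \<gamma> j t \<omega>"
      unfolding time_changed_def by (rule tendsto_vec_nth)
  next
    show "(\<lambda>\<omega>. W (real (k n \<omega>) / real (Suc n)) \<omega> $ j) \<in> borel_measurable (restrict_space M (space M - N))" for n
      by (rule measurable_restrict_space1[OF Wk])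
  qed
  then have "time_changed W \<gamma> j t \<in> borel_measurable (restrict_space M (space M))"
    by (rule borel_measurable_restrict_null[rotated]) (rule null)
  then show ?thesis
    by (subst (asm) measurable_cong_sets[of _ M borel borel]) (auto simp: sets_restrict_space sets.Int_space_eq1 image_iff)
qed

text \<open>A Riemann sum uses the previous iterate at finitely many deterministic times up to
  \<open>s\<close>, so the induction applies to each of them. \<open>R\<close> will be the event
  that t is before the lifetime, with a null set removed.\<close>

lemma borel_measurable_picard:
  fixes R :: "'a measure"
  assumes path: "\<And>\<omega>. \<omega> \<in> space R \<Longrightarrow> rate_path (G \<omega>) \<kappa> a \<theta> \<sigma> \<rho> x0 c \<epsilon> (v \<omega>) (g \<omega>) (T \<omega>)"
    and t: "0 \<le> t" "\<And>\<omega>. \<omega> \<in> space R \<Longrightarrow> ennreal t < T \<omega>"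
    and G: "\<And>s. 0 \<le> s \<Longrightarrow> s \<le> t \<Longrightarrow> (\<lambda>\<omega>. G \<omega> s) \<in> borel_measurable R"
    and v: "\<And>s. 0 \<le> s \<Longrightarrow> s \<le> t \<Longrightarrow> (\<lambda>\<omega>. v \<omega> s) \<in> borel_measurable R"
    and g: "\<And>s. 0 \<le> s \<Longrightarrow> s \<le> t \<Longrightarrow> (\<lambda>\<omega>. g \<omega> s) \<in> borel_measurable R"
    and s: "0 \<le> s" "s \<le> t"
  shows "(\<lambda>\<omega>. rate_path.picard (G \<omega>) \<kappa> a \<theta> \<sigma> \<rho> x0 (v \<omega>) (g \<omega>) n s) \<in> borel_measurable R"
  using s
proof (induction n arbitrary: s)
  case 0
  show ?case
    by (subst measurable_cong[where g = "\<lambda>_. x0"]) (simp_all add: rate_path.picard.simps[OF path])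
next
  case (Suc n)
  let ?x = "\<lambda>\<omega>. rate_path.picard (G \<omega>) \<kappa> a \<theta> \<sigma> \<rho> x0 (v \<omega>) (g \<omega>) n"
  show ?case
  proof (rule borel_measurable_LIMSEQ_real)
    fix \<omega> assume \<omega>: "\<omega> \<in> space R"
    have sT: "ennreal s < T \<omega>" using t(2)[OF \<omega>] Suc.prems by (meson ennreal_leI le_less_trans)
    show "(\<lambda>k. rate_path.riemann_rhs (G \<omega>) \<kappa> a \<theta> \<sigma> \<rho> x0 (v \<omega>) (g \<omega>) (?x \<omega>) s k)
        \<longlonglongrightarrow> rate_path.picard (G \<omega>) \<kappa> a \<theta> \<sigma> \<rho> x0 (v \<omega>) (g \<omega>) (Suc n) s"
      unfolding rate_path.picard.simps(2)[OF path[OF \<omega>]]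
      by (rule rate_path.riemann_rhs_tendsto[OF path[OF \<omega>] rate_path.picard_admissible[OF path[OF \<omega>] sT] sT Suc.prems(1)])
  next
    fix k
    let ?h = "\<lambda>\<omega>. x0
      + (\<Sum>j<Suc k. (\<kappa> * (a - ?x \<omega> (grid s k j)) - \<sigma> * \<rho> * sqrt (v \<omega> (grid s k j) * ?x \<omega> (grid s k j))) * (grid s k (Suc j) - grid s k j))
      + \<theta> * (g \<omega> s - g \<omega> 0)
      + \<sigma> * (\<Sum>j<Suc k. sqrt (?x \<omega> (grid s k j)) * (G \<omega> (grid s k (Suc j)) - G \<omega> (grid s k j)))"
    have grid: "0 \<le> grid s k j" "grid s k j \<le> s" "grid s k j \<le> t" if "j \<le> Suc k" for j
      using grid_nonneg[OF Suc.prems(1)] grid_le[OF Suc.prems(1) that] Suc.prems(2) by auto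
    have "?h \<in> borel_measurable R"
      by (intro borel_measurable_add borel_measurable_sum borel_measurable_times borel_measurable_diff
          borel_measurable_const measurable_compose[OF _ borel_measurable_sqrt] Suc.IH G v g grid Suc.prems t order_refl) auto
    moreover have "rate_path.riemann_rhs (G \<omega>) \<kappa> a \<theta> \<sigma> \<rho> x0 (v \<omega>) (g \<omega>) (?x \<omega>) s k = ?h \<omega>"
      if "\<omega> \<in> space R" for \<omega>
      unfolding rate_path.riemann_rhs_def[OF path[OF that]] rate_path.drift_def[OF path[OF that]] ..
    ultimately show "(\<lambda>\<omega>. rate_path.riemann_rhs (G \<omega>) \<kappa> a \<theta> \<sigma> \<rho> x0 (v \<omega>) (g \<omega>) (?x \<omega>) s k) \<in> borel_measurable R"
      by (subst measurable_cong) auto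
  qed
qed

section \<open>The theorem\<close>

lemma ex_pos_factor:
  fixes A B :: real
  assumes "0 < b" "0 < d"
  obtains e where "0 < e" "A * e \<le> b" "B * e \<le> d"
proof
  let ?e = "min (b / (\<bar>A\<bar> + 1)) (d / (\<bar>B\<bar> + 1))"
  have "C * e \<le> c" if "0 < c" "0 < e" "e \<le> c / (\<bar>C\<bar> + 1)" for C c e :: real
  proof -
    have "C * e \<le> (\<bar>C\<bar> + 1) * e" using that by (intro mult_right_mono) auto
    also have "\<dots> \<le> c" using that by (simp add: pos_le_divide_eq mult.commute)
    finally show ?thesis .
  qed
  note * = this
  show pos: "0 < ?e" using assms by simp
  show "A * ?e \<le> b" by (rule *[OF assms(1) pos]) simp
  show "B * ?e \<le> d" by (rule *[OF assms(2) pos]) simp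
qed

lemma rational_between:
  assumes "0 \<le> t" "ennreal t < T"
  obtains q where "q \<in> \<rat>" "t < q" "ennreal q < T"
  using ennreal_rat_dense[OF assms(2)] assms(1) by (metis Rats_of_rat ennreal_leI not_le)

theorem theorem3p4:
  fixes M :: "'a measure" and F :: "ennreal \<Rightarrow> 'a measure"
    and W :: "real \<Rightarrow> 'a \<Rightarrow> real^4" and \<gamma> :: "real \<Rightarrow> 'a \<Rightarrow> real"
    and \<rho>sv \<rho>sd \<rho>sf \<rho>vd \<rho>vf \<rho>df \<alpha> \<beta> :: real
    and \<kappa>v \<kappa>f av af \<sigma>v \<sigma>f \<theta>v \<theta>f V0 r0 :: real
    and V :: "real \<Rightarrow> 'a \<Rightarrow> real" and \<tau>V :: "'a \<Rightarrow> ennreal"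
  assumes "complete_filtered_prob_space M F"
    and "\<forall>\<rho>\<in>{\<rho>sv, \<rho>sd, \<rho>sf, \<rho>vd, \<rho>vf, \<rho>df}. - 1 < \<rho> \<and> \<rho> < 1"
    and "positive_definite (corr_matrix \<rho>sv \<rho>sd \<rho>sf \<rho>vd \<rho>vf \<rho>df)"
    and "brownian_motion M F (corr_matrix \<rho>sv \<rho>sd \<rho>sf \<rho>vd \<rho>vf \<rho>df) W"
    and "\<alpha> > 0" "\<beta> > 0"
    and "gamma_subordinator M F \<alpha> \<beta> \<gamma>"
    and "independent_processes M W \<gamma>"
    and "\<forall>j. AE \<omega> in M. \<forall>t\<ge>0. bounded_variation_on (\<lambda>s. time_changed W \<gamma> j s \<omega>) 0 t"
    and "\<kappa>v > 0" "\<kappa>f > 0" "av > 0" "af > 0" "\<sigma>v > 0" "\<sigma>f > 0" "\<theta>v \<ge> 0" "\<theta>f \<ge> 0"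
    and "V0 > 0" "r0 > 0"
    and "pathwise_unique_nonneg_strong_solution M {\<gamma>, time_changed W \<gamma> 2} (\<lambda>_. \<infinity>)
      (\<lambda>\<omega>. variance_equation \<kappa>v av \<theta>v \<sigma>v V0 (\<lambda>t. \<gamma> t \<omega>) (\<lambda>t. time_changed W \<gamma> 2 t \<omega>))
      \<tau>V V"
  shows "\<exists>\<tau>f r. pathwise_unique_nonneg_strong_solution M
      {\<gamma>, time_changed W \<gamma> 2, time_changed W \<gamma> 4} \<tau>V
      (\<lambda>\<omega>. foreign_rate_equation \<kappa>f af \<theta>f \<sigma>f \<rho>sf r0 (\<lambda>t. V t \<omega>)
        (\<lambda>t. \<gamma> t \<omega>) (\<lambda>t. time_changed W \<gamma> 4 t \<omega>))
      \<tau>f r"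
proof -
  define G where "G = time_changed W \<gamma> 4"
  define D where "D = {\<gamma>, time_changed W \<gamma> 2, G}"
  define F2 where "F2 = usual_augmentation M {\<gamma>, time_changed W \<gamma> 2}"
  define F3 where "F3 = usual_augmentation M D"
  note complete_filt = assms(1)[unfolded complete_filtered_prob_space_def]
  note BM = assms(4)[unfolded brownian_motion_def adapted_independent_increments_def]
  note gam = assms(7)[unfolded gamma_subordinator_def levy_process_def adapted_independent_increments_def]
  note sol = assms(20)[unfolded pathwise_unique_nonneg_strong_solution_def strong_solution_def]

  have "subalgebra M (F t)" for t
    using complete_filt unfolding subalgebra_def by (auto simp: filtration.space_F)
  note from_F = measurable_from_subalg[OF this]
  have W_meas: "W t \<in> borel_measurable M" and \<gamma>_meas: "\<gamma> t \<in> borel_measurable M" if "0 \<le> t" for t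
    using BM gam that by (auto intro: from_F)

  have "AE \<omega> in M. mono_on {0..} (\<lambda>t. \<gamma> t \<omega>)" "AE \<omega> in M. \<gamma> 0 \<omega> = 0"
    "AE \<omega> in M. cadlag_before \<infinity> (\<lambda>t. \<gamma> t \<omega>)"
    using gam by blast+
  moreover have "AE \<omega> in M. continuous_on {0..} (\<lambda>t. W t \<omega>)"
    using BM by blast
  moreover have "AE \<omega> in M. \<forall>t\<ge>0. bounded_variation_on (\<lambda>s. G s \<omega>) 0 t"
    using assms(9) unfolding G_def by blast
  moreover have "AE \<omega> in M. cadlag_before (\<tau>V \<omega>) (\<lambda>t. V t \<omega>)" "AE \<omega> in M. 0 < \<tau>V \<omega>"
    "AE \<omega> in M. \<forall>t\<ge>0. ennreal t < \<tau>V \<omega> \<longrightarrow> 0 \<le> V t \<omega>"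
    using sol by blast+
  moreover have "AE \<omega> in M. \<forall>t\<ge>0. ennreal t < \<tau>V \<omega> \<longrightarrow>
      variance_equation \<kappa>v av \<theta>v \<sigma>v V0 (\<lambda>t. \<gamma> t \<omega>) (\<lambda>t. time_changed W \<gamma> 2 t \<omega>) (\<lambda>t. V t \<omega>) t"
    using sol by blast
  ultimately have "AE \<omega> in M. mono_on {0..} (\<lambda>t. \<gamma> t \<omega>) \<and> \<gamma> 0 \<omega> = 0 \<and> cadlag_before \<infinity> (\<lambda>t. \<gamma> t \<omega>)
      \<and> continuous_on {0..} (\<lambda>t. W t \<omega>) \<and> (\<forall>t\<ge>0. bounded_variation_on (\<lambda>s. G s \<omega>) 0 t)
      \<and> cadlag_before (\<tau>V \<omega>) (\<lambda>t. V t \<omega>) \<and> (\<forall>t\<ge>0. ennreal t < \<tau>V \<omega> \<longrightarrow> 0 \<le> V t \<omega>)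
      \<and> (\<forall>t\<ge>0. ennreal t < \<tau>V \<omega> \<longrightarrow> variance_equation \<kappa>v av \<theta>v \<sigma>v V0 (\<lambda>t. \<gamma> t \<omega>) (\<lambda>t. time_changed W \<gamma> 2 t \<omega>) (\<lambda>t. V t \<omega>) t)
      \<and> 0 < \<tau>V \<omega>"
    by eventually_elim (intro conjI; assumption)
  \<comment> \<open>A single null set collects all exceptional outcomes; off it the deterministic
    results apply.\<close>
  then obtain N where N: "N \<in> null_sets M" and good: "\<And>\<omega>. \<omega> \<in> space M - N \<Longrightarrow>
      mono_on {0..} (\<lambda>t. \<gamma> t \<omega>) \<and> \<gamma> 0 \<omega> = 0 \<and> cadlag_before \<infinity> (\<lambda>t. \<gamma> t \<omega>)
      \<and> continuous_on {0..} (\<lambda>t. W t \<omega>) \<and> (\<forall>t\<ge>0. bounded_variation_on (\<lambda>s. G s \<omega>) 0 t)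
      \<and> cadlag_before (\<tau>V \<omega>) (\<lambda>t. V t \<omega>) \<and> (\<forall>t\<ge>0. ennreal t < \<tau>V \<omega> \<longrightarrow> 0 \<le> V t \<omega>)
      \<and> (\<forall>t\<ge>0. ennreal t < \<tau>V \<omega> \<longrightarrow> variance_equation \<kappa>v av \<theta>v \<sigma>v V0 (\<lambda>t. \<gamma> t \<omega>) (\<lambda>t. time_changed W \<gamma> 2 t \<omega>) (\<lambda>t. V t \<omega>) t)
      \<and> 0 < \<tau>V \<omega>"
    by (elim AE_E3) blast
  have AE_N: "AE \<omega> in M. P \<omega>" if "\<And>\<omega>. \<omega> \<in> space M - N \<Longrightarrow> P \<omega>" for P
    by (rule AE_I'[OF N]) (use that in auto)
  have subset_N: "Z \<in> null_sets M" if "Z \<subseteq> N" for Z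
    using complete_measure.complete2[OF _ that N] complete_filt by blast

  have \<gamma>_mono: "\<gamma> s \<omega> \<le> \<gamma> t \<omega>" if "\<omega> \<in> space M - N" "0 \<le> s" "s \<le> t" for \<omega> s t
    using good[OF that(1)] that(2,3) by (auto simp: mono_on_def)
  have \<gamma>_nonneg: "0 \<le> \<gamma> t \<omega>" if "\<omega> \<in> space M - N" "0 \<le> t" for \<omega> t
    using good[OF that(1)] \<gamma>_mono[OF that(1) order_refl that(2)] by simp
  have \<gamma>_rc: "((\<lambda>t. \<gamma> t \<omega>) \<longlongrightarrow> \<gamma> t \<omega>) (at_right t)" if "\<omega> \<in> space M - N" "0 \<le> t" for \<omega> t
    using good[OF that(1)] that(2) by (auto simp: cadlag_before_def)
  have G_bv: "bv_integrator (\<lambda>t. G t \<omega>)" if \<omega>: "\<omega> \<in> space M - N" for \<omega>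
  proof
    show "bounded_variation_on (\<lambda>t. G t \<omega>) 0 t" if "0 \<le> t" for t using good[OF \<omega>] that by blast
    fix t :: real assume t: "0 \<le> t"
    have cont: "continuous_on {0..} (\<lambda>t. W t \<omega>)" using good[OF \<omega>] by blast
    have "\<forall>\<^sub>F s in at_right t. \<gamma> s \<omega> \<in> {0..}"
      using \<gamma>_nonneg[OF \<omega>] t by (intro eventually_mono[OF eventually_at_right_less[of t]]) simp
    then have "((\<lambda>s. W (\<gamma> s \<omega>) \<omega>) \<longlongrightarrow> W (\<gamma> t \<omega>) \<omega>) (at_right t)"
      using \<gamma>_nonneg[OF \<omega> t] by (intro continuous_on_tendsto_compose[OF cont \<gamma>_rc[OF \<omega> t]]) auto
    then show "((\<lambda>t. G t \<omega>) \<longlongrightarrow> G t \<omega>) (at_right t)"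
      unfolding G_def time_changed_def by (rule tendsto_vec_nth)
  qed
  have V_0: "V 0 \<omega> = V0" if "\<omega> \<in> space M - N" for \<omega>
  proof -
    have "variance_equation \<kappa>v av \<theta>v \<sigma>v V0 (\<lambda>t. \<gamma> t \<omega>) (\<lambda>t. time_changed W \<gamma> 2 t \<omega>) (\<lambda>t. V t \<omega>) 0"
      using good[OF that] by simp
    then show ?thesis
      using set_integral_lborel_singleton(2)[of 0]
      by (simp add: variance_equation_def stieltjes_integral_def set_lebesgue_integral_def)
  qed

  have G_meas: "G t \<in> borel_measurable M" if "0 \<le> t" for t
    unfolding G_def
    by (rule borel_measurable_time_changed[where N = N])
      (use subset_N W_meas \<gamma>_meas \<gamma>_nonneg good that in auto)
  have \<gamma>_F3: "\<gamma> s \<in> borel_measurable (F3 (ennreal t))" and G_F3: "G s \<in> borel_measurable (F3 (ennreal t))"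
    if "0 \<le> s" "s \<le> t" for s t
    unfolding F3_def using that \<gamma>_meas G_meas
    by (auto intro!: borel_measurable_usual_augmentation simp: D_def)
  have space_F [simp]: "space (F2 t) = space M" "space (F3 t) = space M" for t
    by (simp_all add: F2_def F3_def)
  have F2_F3: "sets (F2 t) \<subseteq> sets (F3 u)" if "t \<le> u" for t u
    unfolding F2_def F3_def using that by (intro usual_augmentation_mono) (auto simp: D_def)
  have V_F2: "V t \<in> borel_measurable (restrict_space (F2 (ennreal t)) {\<omega> \<in> space M. ennreal t < \<tau>V \<omega>})"
    if "0 \<le> t" for t
    using sol that unfolding F2_def by blast
  have \<tau>V_F2: "{\<omega> \<in> space M. ennreal t < \<tau>V \<omega>} \<in> sets (F2 (ennreal t))" for t
    using stopping_timeD2[of F2 \<tau>V "ennreal t"] sol unfolding F2_def by (simp add: pred_def)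

  \<comment> \<open>Any deterministic bound above V0 would do: \<open>V\<close> starts at V0 and is
    right-continuous, so it stays below \<open>c\<close> for a positive time.\<close>
  define c where "c = V0 + 1"
  obtain \<epsilon> where \<epsilon>: "0 < \<epsilon>"
    "(\<kappa>f * (af + 2 * r0) + \<sigma>f * \<bar>\<rho>sf\<bar> * sqrt (c * (2 * r0)) + \<theta>f + \<sigma>f * sqrt (2 * r0)) * \<epsilon> \<le> r0 / 4"
    "(\<kappa>f + \<sigma>f * \<bar>\<rho>sf\<bar> * sqrt c / sqrt r0 + \<sigma>f / sqrt r0) * \<epsilon> \<le> 1 / 2"
    using ex_pos_factor[of "r0 / 4" "1 / 2"] assms(19) by auto
  \<comment> \<open>One half of \<epsilon> is for time and subordinator, the other for the
    variation, expressed by countably many grid sums. The first condition confines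
    \<open>V q\<close> to the event where it is measurable, and it also forces \<tau> to be at most
    \<tau>V.\<close>
  define A where "A q = {\<omega> \<in> space M. ennreal q < \<tau>V \<omega> \<and> V q \<omega> \<le> c \<and> q + (\<gamma> q \<omega> - \<gamma> 0 \<omega>) \<le> \<epsilon> / 2
    \<and> (\<forall>n. (\<Sum>j<Suc n. \<bar>G (grid q n (Suc j)) \<omega> - G (grid q n j) \<omega>\<bar>) \<le> \<epsilon> / 2)}" for q
  define \<tau> where "\<tau> = first_rational_time (\<lambda>q. space M - A q)"

  have A_F3: "A q \<in> sets (F3 (ennreal q))" if q: "0 \<le> q" for q
  proof -
    let ?S = "{\<omega> \<in> space M. ennreal q < \<tau>V \<omega>}"
    have "V q -` {..c} \<inter> space (restrict_space (F2 (ennreal q)) ?S) \<in> sets (restrict_space (F2 (ennreal q)) ?S)"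
      by (rule measurable_sets[OF V_F2[OF q]]) simp
    moreover have S: "?S \<inter> space (F2 (ennreal q)) = ?S" by auto
    ultimately have "V q -` {..c} \<inter> ?S \<in> sets (F2 (ennreal q))"
      using \<tau>V_F2[of q] sets_restrict_space_iff[of ?S "F2 (ennreal q)"]
      unfolding space_restrict_space S by blast
    then have 1: "V q -` {..c} \<inter> ?S \<in> sets (F3 (ennreal q))" using F2_F3 by blast
    have grid: "0 \<le> grid q n j" "grid q n j \<le> q" if "j \<le> Suc n" for n j
      using grid_nonneg[OF q] grid_le[OF q that] by auto
    have "(\<lambda>\<omega>. \<Sum>j<Suc n. \<bar>G (grid q n (Suc j)) \<omega> - G (grid q n j) \<omega>\<bar>) \<in> borel_measurable (F3 (ennreal q))" for n
      by (intro borel_measurable_sum borel_measurable_abs borel_measurable_diff G_F3 grid) auto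
    from borel_measurable_le[OF this borel_measurable_const]
    have 2: "{\<omega> \<in> space M. \<forall>n. (\<Sum>j<Suc n. \<bar>G (grid q n (Suc j)) \<omega> - G (grid q n j) \<omega>\<bar>) \<le> \<epsilon> / 2} \<in> sets (F3 (ennreal q))"
      unfolding space_F by (intro sets.sets_Collect_countable_All[of "F3 (ennreal q)", unfolded space_F])
    have "(\<lambda>\<omega>. q + (\<gamma> q \<omega> - \<gamma> 0 \<omega>)) \<in> borel_measurable (F3 (ennreal q))"
      by (intro borel_measurable_add borel_measurable_diff borel_measurable_const \<gamma>_F3 q order_refl)
    from borel_measurable_le[OF this borel_measurable_const]
    have 3: "{\<omega> \<in> space M. q + (\<gamma> q \<omega> - \<gamma> 0 \<omega>) \<le> \<epsilon> / 2} \<in> sets (F3 (ennreal q))"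
      unfolding space_F .
    have "A q = (V q -` {..c} \<inter> ?S)
        \<inter> {\<omega> \<in> space M. \<forall>n. (\<Sum>j<Suc n. \<bar>G (grid q n (Suc j)) \<omega> - G (grid q n j) \<omega>\<bar>) \<le> \<epsilon> / 2}
        \<inter> {\<omega> \<in> space M. q + (\<gamma> q \<omega> - \<gamma> 0 \<omega>) \<le> \<epsilon> / 2}"
      unfolding A_def by (auto simp del: sum.lessThan_Suc)
    then show ?thesis using 1 2 3 by (simp only: sets.Int)
  qed
  have \<tau>_stopping: "stopping_time F3 \<tau>"
    unfolding \<tau>_def F3_def
  proof (rule stopping_time_first_rational_time)
    show "space M - A q \<in> sets (usual_augmentation M D (ennreal q))" if "0 \<le> q" for q
      using sets.compl_sets[OF A_F3[OF that]] by (simp add: F3_def)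
  qed
  have in_A: "\<omega> \<in> A q" if "\<omega> \<in> space M" "q \<in> \<rat>" "0 \<le> q" "ennreal q < \<tau> \<omega>" for \<omega> q
    using first_rational_time_le[of q \<omega> "\<lambda>q. space M - A q"] that unfolding \<tau>_def by force
  have \<tau>_le: "\<tau> \<omega> \<le> \<tau>V \<omega>" if "\<omega> \<in> space M" for \<omega>
  proof (rule ccontr)
    assume "\<not> \<tau> \<omega> \<le> \<tau>V \<omega>"
    then obtain r where r: "\<tau>V \<omega> < ennreal (real_of_rat r)" "ennreal (real_of_rat r) < \<tau> \<omega>"
      using ennreal_rat_dense[of "\<tau>V \<omega>" "\<tau> \<omega>"] by (auto simp: not_le)
    then have "0 \<le> real_of_rat r" by (metis ennreal_neg not_less_zero nle_le)
    then have "\<omega> \<in> A (real_of_rat r)" using r(2) by (intro in_A that) auto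
    then show False using r(1) by (auto simp: A_def)
  qed
  have \<tau>_pos: "0 < \<tau> \<omega>" if \<omega>: "\<omega> \<in> space M - N" for \<omega>
  proof -
    interpret bv_integrator "\<lambda>t. G t \<omega>" by (rule G_bv[OF \<omega>])
    have \<gamma>0: "\<gamma> 0 \<omega> = 0" and V_rc: "((\<lambda>t. V t \<omega>) \<longlongrightarrow> V 0 \<omega>) (at_right 0)" and \<tau>V: "0 < \<tau>V \<omega>"
      using good[OF \<omega>] unfolding cadlag_before_def by auto
    obtain b where b: "0 < b" "ennreal b < \<tau>V \<omega>"
      using rational_between[of 0 "\<tau>V \<omega>"] \<tau>V by auto
    have "\<forall>\<^sub>F q in at_right 0. q < b"
      by (rule order_tendstoD(2)[OF tendsto_ident_at b(1)])
    moreover have "\<forall>\<^sub>F q in at_right 0. V q \<omega> < c"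
      using V_rc by (rule order_tendstoD) (simp add: V_0[OF \<omega>] c_def)
    moreover have "((\<lambda>q. q + \<gamma> q \<omega>) \<longlongrightarrow> 0 + \<gamma> 0 \<omega>) (at_right 0)"
      by (intro tendsto_intros \<gamma>_rc[OF \<omega>]) simp
    then have "\<forall>\<^sub>F q in at_right 0. q + \<gamma> q \<omega> < \<epsilon> / 2"
      by (rule order_tendstoD) (use \<epsilon>(1) \<gamma>0 in simp)
    \<comment> \<open>Right-continuity of the variation is decisive here: \<open>TV\<close> starts
      at 0 and cannot jump up immediately.\<close>
    moreover have "\<forall>\<^sub>F q in at_right 0. TV q < \<epsilon> / 2"
      using TV_right_cont[OF order_refl] by (rule order_tendstoD) (use \<epsilon>(1) in simp)
    ultimately have "\<forall>\<^sub>F q in at_right 0. q < b \<and> V q \<omega> < c \<and> q + \<gamma> q \<omega> < \<epsilon> / 2 \<and> TV q < \<epsilon> / 2"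
      by eventually_elim blast
    then obtain \<delta> where \<delta>: "0 < \<delta>" "\<And>q. 0 < q \<Longrightarrow> q < \<delta> \<Longrightarrow> q < b \<and> V q \<omega> < c \<and> q + \<gamma> q \<omega> < \<epsilon> / 2 \<and> TV q < \<epsilon> / 2"
      unfolding eventually_at_right_field by blast
    have "\<omega> \<in> A q" if q: "0 \<le> q" "q < \<delta>" for q
    proof -
      \<comment> \<open>Time 0 is rational and counts in \<tau>, but \<open>at_right 0\<close>
        excludes it, so it is checked separately.\<close>
      have *: "q < b \<and> V q \<omega> \<le> c \<and> q + \<gamma> q \<omega> \<le> \<epsilon> / 2 \<and> TV q \<le> \<epsilon> / 2"
      proof (cases "q = 0")
        case True
        then show ?thesis using b V_0[OF \<omega>] \<gamma>0 \<epsilon>(1) by (simp add: c_def)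
      next
        case False
        then show ?thesis using \<delta>(2)[of q] q by auto
      qed
      moreover have "ennreal q < \<tau>V \<omega>" using * b by (meson ennreal_leI le_less_trans less_imp_le)
      moreover have "(\<Sum>j<Suc n. \<bar>G (grid q n (Suc j)) \<omega> - G (grid q n j) \<omega>\<bar>) \<le> \<epsilon> / 2" for n
        using grid_variation_le[OF q(1) bv, of n] * by linarith
      ultimately show ?thesis using \<omega> \<gamma>0 unfolding A_def by simp
    qed
    then have "\<not> \<tau> \<omega> < ennreal \<delta>"
      unfolding \<tau>_def first_rational_time_less_iff by (auto simp: ennreal_less_iff)
    then show ?thesis using \<delta>(1) by (metis ennreal_less_zero_iff leI less_le_trans)
  qed
  have path: "rate_path (\<lambda>t. G t \<omega>) \<kappa>f af \<theta>f \<sigma>f \<rho>sf r0 c \<epsilon> (\<lambda>t. V t \<omega>) (\<lambda>t. \<gamma> t \<omega>) (\<tau> \<omega>)"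
    if \<omega>: "\<omega> \<in> space M - N" for \<omega>
  proof -
    interpret bv_integrator "\<lambda>t. G t \<omega>" by (rule G_bv[OF \<omega>])
    have \<tau>V: "ennreal t < \<tau>V \<omega>" if "ennreal t < \<tau> \<omega>" for t
      using less_le_trans[OF that \<tau>_le] \<omega> by simp
    show ?thesis
    proof
      show "cadlag_before (\<tau> \<omega>) (\<lambda>t. V t \<omega>)"
        using good[OF \<omega>] \<tau>V unfolding cadlag_before_def by blast
      show "0 \<le> V t \<omega> \<and> V t \<omega> \<le> c" if t: "0 \<le> t" "ennreal t < \<tau> \<omega>" for t
      proof
        show "0 \<le> V t \<omega>" using good[OF \<omega>] \<tau>V t by blast
        \<comment> \<open>The bound is known at rational times only. If it failed at
          \<open>t\<close>, right-continuity would make it fail on an interval to the right of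
          \<open>t\<close>, which contains a rational time before \<tau>.\<close>
        show "V t \<omega> \<le> c"
        proof (rule ccontr)
          assume "\<not> V t \<omega> \<le> c"
          moreover have "((\<lambda>t. V t \<omega>) \<longlongrightarrow> V t \<omega>) (at_right t)"
            using good[OF \<omega>] \<tau>V t unfolding cadlag_before_def by blast
          ultimately have "\<forall>\<^sub>F s in at_right t. c < V s \<omega>" by (intro order_tendstoD) auto
          then obtain b where b: "t < b" "\<And>s. t < s \<Longrightarrow> s < b \<Longrightarrow> c < V s \<omega>"
            unfolding eventually_at_right_field by blast
          have "ennreal t < min (\<tau> \<omega>) (ennreal b)" using t b(1) by (simp add: ennreal_less_iff)
          then obtain q where q: "q \<in> \<rat>" "t < q" "ennreal q < min (\<tau> \<omega>) (ennreal b)"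
            using rational_between[OF t(1)] by blast
          then have "\<omega> \<in> A q" using \<omega> t by (intro in_A) auto
          moreover have "q < b" using q t by (simp add: ennreal_less_iff)
          ultimately show False using b(2)[OF q(2)] by (auto simp: A_def)
        qed
      qed
      show "t + (\<gamma> t \<omega> - \<gamma> 0 \<omega>) + TV t \<le> \<epsilon>" if t: "0 \<le> t" "ennreal t < \<tau> \<omega>" for t
      proof -
        \<comment> \<open>Unlike \<open>V\<close>, all three summands are nondecreasing, so one
          later rational time controls time \<open>t\<close>.\<close>
        obtain q where q: "q \<in> \<rat>" "t < q" "ennreal q < \<tau> \<omega>"
          using rational_between[OF t] by blast
        then have "\<omega> \<in> A q" using \<omega> t by (intro in_A) auto
        then have 1: "q + (\<gamma> q \<omega> - \<gamma> 0 \<omega>) \<le> \<epsilon> / 2"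
          and le: "(\<Sum>j<Suc n. \<bar>G (grid q n (Suc j)) \<omega> - G (grid q n j) \<omega>\<bar>) \<le> \<epsilon> / 2" for n
          unfolding A_def by blast+
        have "TV q \<le> \<epsilon> / 2"
          by (rule total_variation_le_grid[OF _ right_cont le]) (use q t in auto)
        moreover have "TV t \<le> TV q" using TV_increment[of t q] q t by auto
        ultimately show ?thesis using 1 \<gamma>_mono[OF \<omega>, of t q] q t by linarith
      qed
    qed (use assms \<epsilon> \<gamma>_mono[OF \<omega>] \<gamma>_rc[OF \<omega>] in \<open>auto simp: c_def\<close>)
  qed

  \<comment> \<open>On \<open>N\<close> the value may be arbitrary; completeness absorbs it, and
    adaptedness concerns only the event that t is before \<tau>.\<close>
  define r where "r t \<omega> = rate_path.solution (\<lambda>t. G t \<omega>) \<kappa>f af \<theta>f \<sigma>f \<rho>sf r0 (\<lambda>t. V t \<omega>) (\<lambda>t. \<gamma> t \<omega>) t" for t \<omega>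
  have r_adapted: "r t \<in> borel_measurable (restrict_space (F3 (ennreal t)) {\<omega> \<in> space M. ennreal t < \<tau> \<omega>})"
    if t: "0 \<le> t" for t
  proof (rule borel_measurable_restrict_null)
    show "Z \<in> sets (F3 (ennreal t))" if "Z \<subseteq> N" for Z
      unfolding F3_def by (intro null_sets_usual_augmentation subset_N that)
    let ?S = "{\<omega> \<in> space M. ennreal t < \<tau> \<omega>} - N"
    let ?R = "restrict_space (F3 (ennreal t)) ?S"
    have R: "\<omega> \<in> space M - N" "ennreal t < \<tau> \<omega>" if "\<omega> \<in> space ?R" for \<omega>
      using that by (auto simp: space_restrict_space)
    have V_R: "(\<lambda>\<omega>. V s \<omega>) \<in> borel_measurable ?R" if "0 \<le> s" "s \<le> t" for s
    proof (rule borel_measurable_restrict_mono[OF V_F2[OF that(1)]])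
      show "sets (F2 (ennreal s)) \<subseteq> sets (F3 (ennreal t))" by (intro F2_F3 ennreal_leI that)
      show "?S \<subseteq> {\<omega> \<in> space M. ennreal s < \<tau>V \<omega>}"
        using \<tau>_le le_less_trans[OF ennreal_leI[OF that(2)]] by (auto intro: less_le_trans)
    qed simp
    show "r t \<in> borel_measurable ?R"
      unfolding r_def
    proof (rule borel_measurable_LIMSEQ_real)
      show "(\<lambda>n. rate_path.picard (\<lambda>t. G t \<omega>) \<kappa>f af \<theta>f \<sigma>f \<rho>sf r0 (\<lambda>t. V t \<omega>) (\<lambda>t. \<gamma> t \<omega>) n t)
          \<longlonglongrightarrow> rate_path.solution (\<lambda>t. G t \<omega>) \<kappa>f af \<theta>f \<sigma>f \<rho>sf r0 (\<lambda>t. V t \<omega>) (\<lambda>t. \<gamma> t \<omega>) t"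
        if "\<omega> \<in> space ?R" for \<omega>
        by (rule rate_path.picard_tendsto(1)[OF path[OF R(1)[OF that]] t R(2)[OF that]])
      show "(\<lambda>\<omega>. rate_path.picard (\<lambda>t. G t \<omega>) \<kappa>f af \<theta>f \<sigma>f \<rho>sf r0 (\<lambda>t. V t \<omega>) (\<lambda>t. \<gamma> t \<omega>) n t)
          \<in> borel_measurable ?R" for n
        by (rule borel_measurable_picard[OF path[OF R(1)] t R(2) _ V_R _ t order_refl])
          (auto intro!: measurable_restrict_space1 G_F3 \<gamma>_F3)
    qed
  qed

  let ?E = "\<lambda>\<omega>. foreign_rate_equation \<kappa>f af \<theta>f \<sigma>f \<rho>sf r0 (\<lambda>t. V t \<omega>) (\<lambda>t. \<gamma> t \<omega>) (\<lambda>t. G t \<omega>)"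
  have "strong_solution M D \<tau>V ?E \<tau> r"
    unfolding strong_solution_def F3_def[symmetric]
  proof (intro conjI allI impI)
    show "AE \<omega> in M. cadlag_before (\<tau> \<omega>) (\<lambda>t. r t \<omega>)"
      unfolding r_def by (intro AE_N rate_path.solution_cadlag[OF path])
    show "AE \<omega> in M. \<forall>t\<ge>0. ennreal t < \<tau> \<omega> \<longrightarrow> ?E \<omega> (\<lambda>s. r s \<omega>) t"
      unfolding r_def by (intro AE_N allI impI rate_path.solution_satisfies_equation[OF path])
  qed (use \<tau>_stopping \<tau>_pos \<tau>_le r_adapted in \<open>auto intro: AE_N\<close>)
  moreover have "AE \<omega> in M. \<forall>t\<ge>0. ennreal t < \<tau> \<omega> \<longrightarrow> 0 \<le> r t \<omega>"
  proof (intro AE_N allI impI)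
    fix \<omega> t assume "\<omega> \<in> space M - N" "0 \<le> t" "ennreal t < \<tau> \<omega>"
    then have "\<bar>r t \<omega> - r0\<bar> \<le> r0 / 4"
      unfolding r_def by (intro rate_path.solution_bounds(2)[OF path])
    then show "0 \<le> r t \<omega>" using assms(19) by linarith
  qed
  moreover have "AE \<omega> in M. \<forall>t\<ge>0. ennreal t < min (\<tau> \<omega>) (\<tau>' \<omega>) \<longrightarrow> Y t \<omega> = r t \<omega>"
    if "strong_solution M D \<tau>V ?E \<tau>' Y" for \<tau>' Y
  proof -
    have "AE \<omega> in M. cadlag_before (\<tau>' \<omega>) (\<lambda>t. Y t \<omega>)"
      and "AE \<omega> in M. \<forall>t\<ge>0. ennreal t < \<tau>' \<omega> \<longrightarrow> ?E \<omega> (\<lambda>s. Y s \<omega>) t"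
      using that unfolding strong_solution_def by blast+
    moreover have "AE \<omega> in M. \<omega> \<in> space M - N" by (rule AE_N)
    ultimately show ?thesis
    proof eventually_elim
      case (elim \<omega>)
      show ?case
        unfolding r_def using elim(2)
        by (auto intro!: rate_path.solution_unique[OF path[OF elim(3)] elim(1)])
    qed
  qed
  ultimately have "pathwise_unique_nonneg_strong_solution M D \<tau>V ?E \<tau> r"
    unfolding pathwise_unique_nonneg_strong_solution_def by blast
  then show ?thesis unfolding D_def G_def by blast
qed

end
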